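(* Let $\rho_0\in X$ and consider the initial-value problem $$\rho_t+\left(\rho\,h(-\kappa(\rho)\rho_x)\right)_x=0\ \ (t>0,\ x\in\mathbb{R}),\qquad \lim_{x\to\pm\infty}\rho(t,x)=0\ \ (t>0),\qquad \rho[0]=\rho_0. \quad (\mathrm{IVP})$$ (a) Suppose that $\rho\in C^1(\mathbb{R}_+\times\mathbb{R};[0,R))\cap C^2((0,+\infty)\times\mathbb{R})$ is a classical solution of (IVP) that satisfies $$\inf_{x\in\mathbb{R}}\rho(t,x)=0\ \text{ for all } t\ge 0,\qquad \sup_{x\in\mathbb{R},\,t\ge 0}\rho(t,x)<R, \quad (\mathrm{A})$$ $$\kappa(\rho)\rho_x\in L^\infty(\mathbb{R}_+\times\mathbb{R}), \quad (\mathrm{B})$$ $$\rho[t]\in X\ \text{ for all } t\ge 0. \quad (\mathrm{C})$$ Then the pair $\rho,w$, where $w=h(-\kappa(\rho)\rho_x)$, is also a weak solution of (IVP). (b) Conversely, if the pair $\rho,w$ is a weak solution of (IVP) with $\rho\in C^1(\mathbb{R}_+\times\mathbb{R};[0,R))\cap C^2((0,+\infty)\times\mathbb{R})$, then $\rho$ is also a classical solution of (IVP) that satisfies (A), (B) and (C).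
   Context: $\mathbb{R}_+=[0,+\infty)$. Constants: $R>1$, $b>0$. The function $\kappa\in C^1([0,R);\mathbb{R}_+)$ satisfies $\kappa(\rho)=0$ for $\rho\in[0,1]$ and $\kappa(\rho)>0$ for $\rho\in(1,R)$. The function $h\in C^1(\mathbb{R};(-1,b))$ satisfies $h'\in L^\infty(\mathbb{R})$, $h(0)=0$, $h'(s)>0$ for all $s\in\mathbb{R}$, and is onto $(-1,b)$; $\beta:(-1,b)\to\mathbb{R}$ denotes the inverse of $h$. Define $Q(\rho)=\int_1^\rho(\rho-\tau)\kappa(\tau)\,d\tau$ for $\rho\in[0,R)$, so $Q'(\rho)=\int_1^\rho\kappa(\tau)\,d\tau$. For a function $u(t,x)$, $u[t]$ denotes the profile $x\mapsto u(t,x)$. The set $X$ is $$X=\left\{\rho\in L^1(\mathbb{R})\cap L^\infty(\mathbb{R}):\ \inf_{x\in\mathbb{R}}\rho(x)=0,\ \sup_{x\in\mathbb{R}}\rho(x)<R,\ \lim_{x\to\pm\infty}\rho(x)=0\right\}.$$ A classical solution of (IVP) is a function $\rho\in C^1(\mathbb{R}_+\times\mathbb{R};[0,R))\cap C^2((0,+\infty)\times\mathbb{R})$ satisfying the differential equation for all $t>0$, $x\in\mathbb{R}$, the limits at $\pm\infty$ for all $t>0$, and $\rho(0,\cdot)=\rho_0$. A weak solution of (IVP) is a pair of maps $\rho,w:\mathbb{R}_+\to L^1(\mathbb{R})\cap L^\infty(\mathbb{R})$ such that (1) $\inf_{x\in\mathbb{R}}\rho(t,x)=0$ for all $t\ge0$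 and $\sup_{x\in\mathbb{R},t\ge0}\rho(t,x)<R$; (2) $-1<\inf_{x\in\mathbb{R},t\ge0}w(t,x)\le\sup_{x\in\mathbb{R},t\ge0}w(t,x)<b$; (3) $\int_{-\infty}^{+\infty}\rho(t,x)\,dx=\int_{-\infty}^{+\infty}\rho_0(x)\,dx$ for all $t\ge0$; (4) $\int_{-\infty}^{+\infty}Q(\rho(t,x))\,dx\le\int_{-\infty}^{+\infty}Q(\rho_0(x))\,dx$ for all $t\ge0$; (5) $\lim_{x\to\pm\infty}\rho(t,x)=0$ for all $t>0$; (6) for every $\phi\in C^2(\mathbb{R}_+\times\mathbb{R})$ of compact support (in $[0,+\infty)\times\mathbb{R}$, so $\phi(0,\cdot)$ need not vanish), $$-\int_{-\infty}^{+\infty}\phi(0,x)\rho_0(x)\,dx=\int_0^{+\infty}\int_{-\infty}^{+\infty}\rho(t,x)\left(w(t,x)\phi_x(t,x)+\phi_t(t,x)\right)dx\,dt,$$ $$\int_0^{+\infty}\int_{-\infty}^{+\infty}\left(\phi(t,x)\beta(w(t,x))-\phi_x(t,x)Q'(\rho(t,x))\right)dx\,dt=0.$$ For equivalence classes of functions, inf, sup, limits and equality with $\rho_0$ are understood up to null sets. *)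

theory Defs
  imports "HOL-Analysis.Analysis" "HOL-Probability.Essential_Supremum"
begin

text \<open>Derivatives are taken within \<open>S\<close>, hence are one-sided at boundary points of \<open>S\<close>. The sets
  used below are intervals, the closed half-plane and the open half-plane; there such derivatives
  are unique.\<close>

definition C1_on :: "real set \<Rightarrow> (real \<Rightarrow> real) \<Rightarrow> bool" where
  "C1_on S f \<longleftrightarrow> (\<exists>D. (\<forall>x\<in>S. (f has_real_derivative D x) (at x within S)) \<and> continuous_on S D)"

primrec Ck_on :: "nat \<Rightarrow> (real \<times> real) set \<Rightarrow> (real \<times> real \<Rightarrow> real) \<Rightarrow> bool" where
  "Ck_on 0 S f \<longleftrightarrow> continuous_on S f"
| "Ck_on (Suc k) S f \<longleftrightarrow> (\<exists>f1 f2.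
     (\<forall>p\<in>S. (f has_derivative (\<lambda>v. f1 p * fst v + f2 p * snd v)) (at p within S)) \<and>
     Ck_on k S f1 \<and> Ck_on k S f2)"

abbreviation half_plane :: "(real \<times> real) set" where
  "half_plane \<equiv> {0..} \<times> UNIV"

abbreviation open_half_plane :: "(real \<times> real) set" where
  "open_half_plane \<equiv> {0<..} \<times> UNIV"

text \<open>A function of time and space is curried, \<open>u t\<close> being its profile at time \<open>t\<close>; its values at
  \<open>t < 0\<close> are irrelevant.\<close>

definition solution_regularity :: "real \<Rightarrow> (real \<Rightarrow> real \<Rightarrow> real) \<Rightarrow> bool" where
  "solution_regularity R \<rho> \<longleftrightarrow>
     (\<forall>t\<ge>0. \<forall>x. \<rho> t x \<in> {0..<R}) \<and>
     Ck_on 1 half_plane (\<lambda>(t, x). \<rho> t x) \<and>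
     Ck_on 2 open_half_plane (\<lambda>(t, x). \<rho> t x)"

definition test_function :: "(real \<Rightarrow> real \<Rightarrow> real) \<Rightarrow> bool" where
  "test_function \<phi> \<longleftrightarrow>
     Ck_on 2 half_plane (\<lambda>(t, x). \<phi> t x) \<and>
     compact (closure {(t, x). (t, x) \<in> half_plane \<and> \<phi> t x \<noteq> 0})"

definition Linf :: "'a measure \<Rightarrow> ('a \<Rightarrow> real) \<Rightarrow> bool" where
  "Linf M f \<longleftrightarrow> f \<in> borel_measurable M \<and> (\<exists>C. AE x in M. \<bar>f x\<bar> \<le> C)"

abbreviation L1_Linf :: "(real \<Rightarrow> real) \<Rightarrow> bool" where
  "L1_Linf f \<equiv> integrable lebesgue f \<and> Linf lebesgue f"

abbreviation ess_sup :: "(real \<Rightarrow> real) \<Rightarrow> ereal" where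
  "ess_sup f \<equiv> esssup lebesgue (\<lambda>x. ereal (f x))"

abbreviation ess_inf :: "(real \<Rightarrow> real) \<Rightarrow> ereal" where
  "ess_inf f \<equiv> - esssup lebesgue (\<lambda>x. - ereal (f x))"

definition ess_tendsto :: "(real \<Rightarrow> real) \<Rightarrow> real \<Rightarrow> real filter \<Rightarrow> bool" where
  "ess_tendsto f l F \<longleftrightarrow> (\<exists>g. (AE x in lebesgue. g x = f x) \<and> (g \<longlongrightarrow> l) F)"

definition X_space :: "real \<Rightarrow> (real \<Rightarrow> real) set" where
  "X_space R = {\<rho>. L1_Linf \<rho> \<and> ess_inf \<rho> = 0 \<and> ess_sup \<rho> < ereal R \<and>
     ess_tendsto \<rho> 0 at_top \<and> ess_tendsto \<rho> 0 at_bot}"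

text \<open>The interval integrals are oriented: for \<open>r < 1\<close> they are minus the integrals over \<open>(r, 1)\<close>.
  \<open>Q'\<close> is given by its formula, and not as \<^const>\<open>deriv\<close> of \<open>Q\<close>, because at \<open>r = 0\<close> the latter
  would involve the unspecified values of \<open>\<kappa>\<close> on negative arguments.\<close>

definition Q :: "(real \<Rightarrow> real) \<Rightarrow> real \<Rightarrow> real" where
  "Q \<kappa> r = (LBINT \<tau>=1..ereal r. (r - \<tau>) * \<kappa> \<tau>)"

definition Q' :: "(real \<Rightarrow> real) \<Rightarrow> real \<Rightarrow> real" where
  "Q' \<kappa> r = (LBINT \<tau>=1..ereal r. \<kappa> \<tau>)"

definition velocity :: "(real \<Rightarrow> real) \<Rightarrow> (real \<Rightarrow> real) \<Rightarrow> (real \<Rightarrow> real \<Rightarrow> real) \<Rightarrow> real \<Rightarrow> real \<Rightarrow> real" where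
  "velocity \<kappa> h \<rho> t x = h (- \<kappa> (\<rho> t x) * deriv (\<rho> t) x)"

text \<open>For \<open>\<rho>\<close> of the required regularity (and \<open>\<kappa>\<close>, \<open>h\<close> as in the standing assumptions) the flux is
  differentiable in \<open>x\<close> at every \<open>t > 0\<close>, so both uses of \<^const>\<open>deriv\<close> are meaningful.\<close>

definition classical_solution ::
  "real \<Rightarrow> (real \<Rightarrow> real) \<Rightarrow> (real \<Rightarrow> real) \<Rightarrow> (real \<Rightarrow> real) \<Rightarrow> (real \<Rightarrow> real \<Rightarrow> real) \<Rightarrow> bool" where
  "classical_solution R \<kappa> h \<rho>0 \<rho> \<longleftrightarrow>
     solution_regularity R \<rho> \<and>
     (\<forall>t>0. \<forall>x. deriv (\<lambda>s. \<rho> s x) t + deriv (\<lambda>y. \<rho> t y * velocity \<kappa> h \<rho> t y) x = 0) \<and>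
     (\<forall>t>0. (\<rho> t \<longlongrightarrow> 0) at_top \<and> (\<rho> t \<longlongrightarrow> 0) at_bot) \<and>
     (AE x in lebesgue. \<rho> 0 x = \<rho>0 x)"

text \<open>For \<open>\<rho>\<close> with values in \<open>[0, R)\<close> the sets are bounded, so these real-valued infima and suprema
  are not junk values.\<close>

definition cond_A :: "real \<Rightarrow> (real \<Rightarrow> real \<Rightarrow> real) \<Rightarrow> bool" where
  "cond_A R \<rho> \<longleftrightarrow> (\<forall>t\<ge>0. (INF x. \<rho> t x) = 0) \<and> (SUP (t, x)\<in>half_plane. \<rho> t x) < R"

definition cond_B :: "(real \<Rightarrow> real) \<Rightarrow> (real \<Rightarrow> real \<Rightarrow> real) \<Rightarrow> bool" where
  "cond_B \<kappa> \<rho> \<longleftrightarrow> Linf (lebesgue_on half_plane) (\<lambda>(t, x). \<kappa> (\<rho> t x) * deriv (\<rho> t) x)"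

definition cond_C :: "real \<Rightarrow> (real \<Rightarrow> real \<Rightarrow> real) \<Rightarrow> bool" where
  "cond_C R \<rho> \<longleftrightarrow> (\<forall>t\<ge>0. \<rho> t \<in> X_space R)"

text \<open>In the last clause the outer integrals in \<open>t\<close> are explicitly required to exist, as Isabelle's
  integral of a non-integrable function is 0; all the other integrals exist because of the
  preceding clauses and \<open>\<rho>0 \<in> X_space R\<close> (the inner ones for \<open>t > 0\<close>).
  \<open>inv h\<close> is the inverse \<open>\<beta>\<close> of \<open>h\<close>. The time derivative of \<open>\<phi>\<close> may be two-sided, since \<open>t = 0\<close> does not contribute to the outer integral.\<close>

definition weak_solution ::
  "real \<Rightarrow> real \<Rightarrow> (real \<Rightarrow> real) \<Rightarrow> (real \<Rightarrow> real) \<Rightarrow> (real \<Rightarrow> real) \<Rightarrow>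
     (real \<Rightarrow> real \<Rightarrow> real) \<Rightarrow> (real \<Rightarrow> real \<Rightarrow> real) \<Rightarrow> bool" where
  "weak_solution R b \<kappa> h \<rho>0 \<rho> w \<longleftrightarrow>
     (\<forall>t\<ge>0. L1_Linf (\<rho> t) \<and> L1_Linf (w t)) \<and>
     (\<forall>t\<ge>0. ess_inf (\<rho> t) = 0) \<and> (SUP t\<in>{0..}. ess_sup (\<rho> t)) < ereal R \<and>
     -1 < (INF t\<in>{0..}. ess_inf (w t)) \<and>
     (INF t\<in>{0..}. ess_inf (w t)) \<le> (SUP t\<in>{0..}. ess_sup (w t)) \<and>
     (SUP t\<in>{0..}. ess_sup (w t)) < ereal b \<and>
     (\<forall>t\<ge>0. (LINT x|lebesgue. \<rho> t x) = (LINT x|lebesgue. \<rho>0 x)) \<and>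
     (\<forall>t\<ge>0. (LINT x|lebesgue. Q \<kappa> (\<rho> t x)) \<le> (LINT x|lebesgue. Q \<kappa> (\<rho>0 x))) \<and>
     (\<forall>t>0. ess_tendsto (\<rho> t) 0 at_top \<and> ess_tendsto (\<rho> t) 0 at_bot) \<and>
     (\<forall>\<phi>. test_function \<phi> \<longrightarrow>
        (let I = (\<lambda>t. LINT x|lebesgue.
                    \<rho> t x * (w t x * deriv (\<phi> t) x + deriv (\<lambda>s. \<phi> s x) t));
             J = (\<lambda>t. LINT x|lebesgue.
                    \<phi> t x * inv h (w t x) - deriv (\<phi> t) x * Q' \<kappa> (\<rho> t x))
         in set_integrable lebesgue {0..} I \<and>
            - (LINT x|lebesgue. \<phi> 0 x * \<rho>0 x) = (LINT t:{0..}|lebesgue. I t) \<and>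
            set_integrable lebesgue {0..} J \<and>
            (LINT t:{0..}|lebesgue. J t) = 0))"

end

theory Submission
  imports Defs
begin

text \<open>The conservation of mass, the energy inequality and the first integral identity are integrated
balance laws: if \<open>U_t + V_x = S\<close> on the half-plane, then on \<open>[0,T] \<times> [a,b]\<close> the change of
\<open>\<integral>U dx\<close> plus the net outflow of \<open>V\<close> is \<open>\<integral>\<integral>S\<close> (\<open>balance_law\<close>). For a classical solution,
with \<open>w = h(-\<kappa>(\<rho>)\<rho>_x)\<close>, take \<open>(U, V, S)\<close> to be \<open>(\<rho>, \<rho>w, 0)\<close>,
\<open>(Q(\<rho>), Q'(\<rho>)\<rho>w, \<kappa>(\<rho>)\<rho>_x \<rho>w)\<close> and \<open>(\<rho>\<phi>, \<rho>w\<phi>, \<rho>(\<phi>_t + w\<phi>_x))\<close>,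
respectively; the energy source is nonpositive because \<open>y h(-y) \<le> 0\<close>. The limits \<open>\<rho> \<rightarrow> 0\<close> at
infinity hold for each \<open>t\<close> separately, but the fluxes are bounded, so that their time integrals
vanish in the limit by dominated convergence. As \<open>\<kappa> = 0\<close> on \<open>[0,1]\<close>, each \<open>w[t]\<close> has compact
support and is integrable, and the bound on \<open>\<kappa>(\<rho>)\<rho>_x\<close> keeps \<open>w\<close> away from \<open>-1\<close> and \<open>b\<close>.
The second integral identity is an integration by parts in \<open>x\<close> at fixed \<open>t\<close>.

Conversely, let \<open>\<rho>, w\<close> be a weak solution with \<open>\<rho>\<close> of the required regularity, and test with
products \<open>a(t)c(x)\<close>. After integration by parts in \<open>x\<close> the second identity reads
\<open>\<integral> a(t) (\<integral> c(x) (\<beta>(w) + \<kappa>(\<rho>)\<rho>_x) dx) dt = 0\<close>. For each \<open>c\<close> the inner integral thus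
vanishes for almost all \<open>t\<close>. Letting \<open>c\<close> range over a countable family that still determines
locally integrable functions, one null set of times serves all \<open>c\<close>, whence
\<open>w = h(-\<kappa>(\<rho>)\<rho>_x)\<close> almost everywhere in \<open>x\<close> for almost all \<open>t\<close> (\<open>velocity_law\<close>). The
bounds on \<open>w\<close> pass to the continuous function \<open>h(-\<kappa>(\<rho>)\<rho>_x)\<close>, which bounds
\<open>\<kappa>(\<rho>)\<rho>_x\<close>. Subtracting the balance law for \<open>U = \<rho>\<phi>\<close>, \<open>V = 0\<close> from the first identity leaves
\<open>\<integral> a(t) P(t) dt = a(0) (\<integral>c \<rho>[0] dx - \<integral>c \<rho>0 dx)\<close> with
\<open>P(t) = \<integral> (c' \<rho> h(-\<kappa>(\<rho>)\<rho>_x) - c \<rho>_t) dx\<close> (\<open>tested_continuity_equation\<close>). Functions \<open>a\<close>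
supported in \<open>t > 0\<close> give \<open>P = 0\<close>, that is, the differential equation; a function \<open>a\<close> with
\<open>a(0) > 0\<close> then gives \<open>\<rho>[0] = \<rho>0\<close>.\<close>

section \<open>Lebesgue integrals, essential bounds and continuous functions\<close>

text \<open>By completeness of Lebesgue measure, measurability too is invariant under changes on null sets.\<close>

lemma lebesgue_integrable_cong_AE:
  fixes f g :: "real \<Rightarrow> real"
  assumes "AE x in lebesgue. f x = g x"
  shows "integrable lebesgue f \<longleftrightarrow> integrable lebesgue g"
proof -
  obtain N where N: "N \<in> null_sets lebesgue" "{x. f x \<noteq> g x} \<subseteq> N"
    using assms by (auto simp: eventually_ae_filter)
  then have "negligible N" by (simp add: negligible_iff_null_sets)
  then have "f absolutely_integrable_on UNIV \<longleftrightarrow> g absolutely_integrable_on UNIV"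
    by (rule absolutely_integrable_spike_eq) (use N(2) in force)
  then show ?thesis by (simp add: set_integrable_def)
qed

lemma lebesgue_integral_cong_AE:
  fixes f g :: "real \<Rightarrow> real"
  assumes "AE x in lebesgue. f x = g x"
  shows "(LINT x|lebesgue. f x) = (LINT x|lebesgue. g x)"
proof (cases "integrable lebesgue f")
  case True
  then have "integrable lebesgue g" using lebesgue_integrable_cong_AE[OF assms] by simp
  with True show ?thesis by (intro integral_cong_AE assms) auto
next
  case False
  then have "\<not> integrable lebesgue g" using lebesgue_integrable_cong_AE[OF assms] by simp
  with False show ?thesis by (simp add: not_integrable_integral_eq)
qed

lemma lebesgue_integral_supported:
  fixes f :: "real \<Rightarrow> real"
  assumes "continuous_on {a..b} f" and "\<And>x. x \<notin> {a..b} \<Longrightarrow> f x = 0"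
  shows "integrable lebesgue f" and "(LINT x|lebesgue. f x) = integral {a..b} f"
proof -
  have *: "f absolutely_integrable_on {a..b}"
    using assms(1) by (rule absolutely_integrable_continuous_real)
  have eq: "(\<lambda>x. indicator {a..b} x *\<^sub>R f x) = f"
    by (rule ext) (metis assms(2) indicator_simps real_scaleR_def scale_one scale_zero_left)
  show "integrable lebesgue f" using * unfolding set_integrable_def eq .
  show "(LINT x|lebesgue. f x) = integral {a..b} f"
    using set_lebesgue_integral_eq_integral(2)[OF *] unfolding set_lebesgue_integral_def eq .
qed

text \<open>Otherwise the nonempty open set where \<open>f\<close> leaves \<open>K\<close> would be null. This upgrades almost
everywhere statements about continuous functions to pointwise ones.\<close>

lemma AE_in_closed_imp_all:
  fixes f :: "'a::euclidean_space \<Rightarrow> real"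
  assumes "open S" "continuous_on S f" "closed K" and "AE x in lebesgue. x \<in> S \<longrightarrow> f x \<in> K" "x \<in> S"
  shows "f x \<in> K"
proof (rule ccontr)
  assume "f x \<notin> K"
  let ?U = "{y\<in>S. f y \<in> - K}"
  have "open ?U"
    using continuous_open_preimage[OF assms(2,1), of "- K"] assms(3)
    by (simp add: open_Compl vimage_def Int_def)
  obtain N where N: "N \<in> null_sets lebesgue" "{x. \<not> (x \<in> S \<longrightarrow> f x \<in> K)} \<subseteq> N"
    using assms(4) by (auto simp: eventually_ae_filter)
  then have "negligible N" by (simp add: negligible_iff_null_sets)
  then have "negligible ?U" by (rule negligible_subset) (use N(2) in blast)
  moreover have "x \<in> ?U" using \<open>f x \<notin> K\<close> assms by auto
  ultimately show False using open_not_negligible[OF \<open>open ?U\<close>] by auto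
qed

lemma continuous_measurable_lebesgue:
  "continuous_on UNIV (f::real\<Rightarrow>real) \<Longrightarrow> f \<in> borel_measurable lebesgue"
  by (intro measurable_completion) (simp add: borel_measurable_continuous_onI)

lemma ess_sup_le_iff:
  fixes f :: "real \<Rightarrow> real"
  assumes "f \<in> borel_measurable lebesgue"
  shows "ess_sup f \<le> c \<longleftrightarrow> (AE x in lebesgue. ereal (f x) \<le> c)"
proof
  assume "ess_sup f \<le> c"
  then show "AE x in lebesgue. ereal (f x) \<le> c"
    using esssup_AE[of "\<lambda>x. ereal (f x)" lebesgue] by (auto elim!: eventually_mono)
qed (use assms in \<open>auto intro!: esssup_I\<close>)

lemma ess_inf_ge_iff:
  fixes f :: "real \<Rightarrow> real"
  assumes "f \<in> borel_measurable lebesgue"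
  shows "c \<le> ess_inf f \<longleftrightarrow> (AE x in lebesgue. c \<le> ereal (f x))"
proof -
  have "c \<le> - e \<longleftrightarrow> e \<le> - c" for e :: ereal
    using ereal_minus_le_minus[of "- c" e] by simp
  then have "c \<le> ess_inf f \<longleftrightarrow> ess_sup (\<lambda>x. - f x) \<le> - c"
    by simp
  also have "\<dots> \<longleftrightarrow> (AE x in lebesgue. ereal (- f x) \<le> - c)"
    using assms by (intro ess_sup_le_iff) auto
  also have "\<dots> \<longleftrightarrow> (AE x in lebesgue. c \<le> ereal (f x))"
    by (simp only: uminus_ereal.simps(1)[symmetric] ereal_minus_le_minus)
  finally show ?thesis .
qed

lemma ess_inf_le_ess_sup:
  fixes f :: "real \<Rightarrow> real"
  assumes "f \<in> borel_measurable lebesgue"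
  shows "ess_inf f \<le> ess_sup f"
proof -
  have "AE x in lebesgue. ess_inf f \<le> ereal (f x) \<and> ereal (f x) \<le> ess_sup f"
    using ess_sup_le_iff[OF assms, of "ess_sup f"] ess_inf_ge_iff[OF assms, of "ess_inf f"] by auto
  then have "AE x in (lebesgue::real measure). ess_inf f \<le> ess_sup f"
    by eventually_elim auto
  then show ?thesis
    using eventually_happens'[of "ae_filter lebesgue"] by (auto simp: ae_filter_eq_bot_iff)
qed

lemma continuous_le_ess_sup:
  fixes f :: "real \<Rightarrow> real"
  assumes "continuous_on UNIV f" and "ess_sup f \<le> ereal c"
  shows "f x \<le> c"
  using AE_in_closed_imp_all[OF open_UNIV assms(1) closed_atMost[of c], of x]
    ess_sup_le_iff[OF continuous_measurable_lebesgue[OF assms(1)], of c] assms(2) by auto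

text \<open>The condition on \<open>F\<close>, a filter with a basis of open sets, covers both \<open>at_top\<close> and \<open>at_bot\<close>.
On an open set where the representative is small, \<open>f\<close> is small almost everywhere and hence, by
continuity, everywhere.\<close>

lemma ess_tendsto_continuous:
  assumes "ess_tendsto f 0 F" and "continuous_on UNIV f"
    and F: "\<And>P. eventually P F \<longleftrightarrow> (\<exists>S. open S \<and> (\<forall>x\<in>S. P x) \<and> eventually (\<lambda>x. x \<in> S) F)"
  shows "(f \<longlongrightarrow> 0) F"
proof (rule tendstoI)
  fix e :: real assume "e > 0"
  obtain g where g: "AE x in lebesgue. g x = f x" "(g \<longlongrightarrow> 0) F"
    using assms(1) unfolding ess_tendsto_def by blast
  have "eventually (\<lambda>x. \<bar>g x\<bar> < e / 2) F"
    using tendstoD[OF g(2), of "e/2"] \<open>e > 0\<close> by simp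
  then obtain S where S: "open S" "\<forall>x\<in>S. \<bar>g x\<bar> < e / 2" "eventually (\<lambda>x. x \<in> S) F"
    using F by blast
  have "AE x in lebesgue. x \<in> S \<longrightarrow> f x \<in> {- (e/2)..e/2}"
    using g(1)
  proof eventually_elim
    case (elim x)
    then show ?case using S(2)[rule_format, of x] by (auto simp: abs_less_iff)
  qed
  then have "\<bar>f x\<bar> \<le> e / 2" if "x \<in> S" for x
    using AE_in_closed_imp_all[OF S(1) continuous_on_subset[OF assms(2) subset_UNIV] closed_atLeastAtMost _ that]
    by (metis abs_le_iff atLeastAtMost_iff minus_le_iff)
  with S(3) show "eventually (\<lambda>x. dist (f x) 0 < e) F"
    using \<open>e > 0\<close> by (force elim!: eventually_mono)
qed

lemma ess_tendsto_continuous_at_infinity: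
  assumes "continuous_on UNIV f"
  shows "ess_tendsto f 0 at_top \<Longrightarrow> (f \<longlongrightarrow> 0) at_top"
    and "ess_tendsto f 0 at_bot \<Longrightarrow> (f \<longlongrightarrow> 0) at_bot"
proof -
  have "eventually P at_top \<longleftrightarrow> (\<exists>S. open S \<and> (\<forall>x\<in>S. P x) \<and> eventually (\<lambda>x. x \<in> S) at_top)" for P :: "real \<Rightarrow> bool"
  proof
    assume "eventually P at_top"
    then obtain N where "\<forall>x>N. P x" by (auto simp: eventually_at_top_dense)
    then show "\<exists>S. open S \<and> (\<forall>x\<in>S. P x) \<and> eventually (\<lambda>x. x \<in> S) at_top"
      by (intro exI[of _ "{N<..}"]) (auto simp: eventually_gt_at_top)
  qed (auto elim: eventually_mono)
  then show "ess_tendsto f 0 at_top \<Longrightarrow> (f \<longlongrightarrow> 0) at_top"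
    using ess_tendsto_continuous assms by blast
  have "eventually P at_bot \<longleftrightarrow> (\<exists>S. open S \<and> (\<forall>x\<in>S. P x) \<and> eventually (\<lambda>x. x \<in> S) at_bot)" for P :: "real \<Rightarrow> bool"
  proof
    assume "eventually P at_bot"
    then obtain N where "\<forall>x<N. P x" by (auto simp: eventually_at_bot_dense)
    then show "\<exists>S. open S \<and> (\<forall>x\<in>S. P x) \<and> eventually (\<lambda>x. x \<in> S) at_bot"
      by (intro exI[of _ "{..<N}"]) (auto simp: eventually_gt_at_bot)
  qed (auto elim: eventually_mono)
  then show "ess_tendsto f 0 at_bot \<Longrightarrow> (f \<longlongrightarrow> 0) at_bot"
    using ess_tendsto_continuous assms by blast
qed

text \<open>The outer time integrals of the weak formulation have this shape: the integrand agrees with a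
continuous function \<open>F\<close> for almost all positive times only. At \<open>t = 0\<close> it involves two-sided
time derivatives of the test function, and the velocity of a weak solution is identified for
almost all \<open>t\<close>.\<close>

lemma time_integral_supported:
  fixes I F :: "real \<Rightarrow> real"
  assumes F: "continuous_on {0..} F" and IF: "AE t in lebesgue. t > 0 \<longrightarrow> I t = F t" and z: "\<And>t. t > L \<Longrightarrow> F t = 0" and "L > 0"
  shows "set_integrable lebesgue {0..} I" and "(LINT t:{0..}|lebesgue. I t) = integral {0..L} F"
proof -
  let ?G = "\<lambda>t. if t \<in> {0..L} then F t else 0"
  have "AE t in lebesgue. t \<noteq> (0::real)"
    by (rule AE_completion[OF AE_lborel_singleton])
  then have ae: "AE t in lebesgue. ?G t = indicator {0..} t *\<^sub>R I t"
    using IF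
  proof eventually_elim
    fix t :: real assume t: "t \<noteq> 0" "t > 0 \<longrightarrow> I t = F t"
    then consider "t < 0" | "0 < t" "t \<le> L" | "L < t" by linarith
    then show "?G t = indicator {0..} t *\<^sub>R I t"
      using t(2) z[of t] \<open>L > 0\<close> by cases auto
  qed
  have G: "continuous_on {0..L} ?G"
    by (rule continuous_on_eq[OF continuous_on_subset[OF F]]) auto
  show "set_integrable lebesgue {0..} I"
    unfolding set_integrable_def
    unfolding lebesgue_integrable_cong_AE[OF ae, symmetric] by (rule lebesgue_integral_supported(1)[OF G]) auto
  have "(LINT t:{0..}|lebesgue. I t) = integral {0..L} ?G"
    unfolding set_lebesgue_integral_def
    unfolding lebesgue_integral_cong_AE[OF ae, symmetric] by (rule lebesgue_integral_supported(2)[OF G]) auto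
  also have "\<dots> = integral {0..L} F"
    by (rule Henstock_Kurzweil_Integration.integral_cong) auto
  finally show "(LINT t:{0..}|lebesgue. I t) = integral {0..L} F" .
qed

lemma nonneg_time_le_of_pos_time_le:
  fixes f :: "real \<Rightarrow> real"
  assumes "continuous_on {0..} f" and "\<And>t. t > 0 \<Longrightarrow> f t \<le> c" and "t \<ge> 0"
  shows "f t \<le> c"
  using continuous_le_on_closure[of "{0<..}" f t c] assms by (simp add: closure_greaterThan)

lemma eventually_small_outside_interval:
  fixes f :: "real \<Rightarrow> real"
  assumes "(f \<longlongrightarrow> 0) at_top" "(f \<longlongrightarrow> 0) at_bot" "c > 0"
  obtains N where "N > 0" "\<And>x. \<bar>x\<bar> \<ge> N \<Longrightarrow> f x \<le> c"
proof -
  obtain M where M: "\<And>x. x \<ge> M \<Longrightarrow> f x < c"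
    using order_tendstoD(2)[OF assms(1,3)] by (auto simp: eventually_at_top_linorder)
  obtain M' where M': "\<And>x. x \<le> M' \<Longrightarrow> f x < c"
    using order_tendstoD(2)[OF assms(2,3)] by (auto simp: eventually_at_bot_linorder)
  show thesis
  proof (rule that[of "max 1 (max M (- M'))"])
    fix x assume x: "max 1 (max M (- M')) \<le> \<bar>x\<bar>"
    show "f x \<le> c"
    proof (cases "x \<ge> 0")
      case True
      with x have "M \<le> x" by simp
      then show ?thesis using M[of x] by simp
    next
      case False
      with x have "x \<le> M'" by simp
      then show ?thesis using M'[of x] by simp
    qed
  qed simp
qed

section \<open>Balance laws on the half-plane\<close>

text \<open>The following closure rules keep continuity goals on the half-plane in the curried form
\<open>\<lambda>(t, x). f t x\<close>.\<close>

lemma continuous_on_pair_const: "continuous_on S (\<lambda>(t, x). c)"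
  by (simp add: case_prod_unfold)

lemma continuous_on_pair_arith:
  fixes f g :: "real \<Rightarrow> real \<Rightarrow> real"
  assumes "continuous_on S (\<lambda>(t, x). f t x)" "continuous_on S (\<lambda>(t, x). g t x)"
  shows "continuous_on S (\<lambda>(t, x). f t x + g t x)" "continuous_on S (\<lambda>(t, x). f t x - g t x)"
    "continuous_on S (\<lambda>(t, x). f t x * g t x)"
  using assms unfolding case_prod_unfold by (auto intro: continuous_intros)

lemma continuous_on_pair_minus:
  fixes f :: "real \<Rightarrow> real \<Rightarrow> real"
  shows "continuous_on S (\<lambda>(t, x). f t x) \<Longrightarrow> continuous_on S (\<lambda>(t, x). - f t x)"
  unfolding case_prod_unfold by (auto intro: continuous_intros)

lemma continuous_on_pair_compose:
  fixes f :: "real \<Rightarrow> real \<Rightarrow> real"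
  assumes "continuous_on A g" "continuous_on S (\<lambda>(t, x). f t x)" "\<And>t x. (t, x) \<in> S \<Longrightarrow> f t x \<in> A"
  shows "continuous_on S (\<lambda>(t, x). g (f t x))"
  using assms(2) unfolding case_prod_unfold
  by (rule continuous_on_compose2[OF assms(1)]) (use assms(3) in force)

lemmas continuous_on_pair = continuous_on_pair_const continuous_on_pair_arith continuous_on_pair_minus

lemma continuous_on_slices:
  fixes f :: "real \<Rightarrow> real \<Rightarrow> real"
  assumes "continuous_on (S \<times> UNIV) (\<lambda>(t, x). f t x)"
  shows "t \<in> S \<Longrightarrow> continuous_on A (f t)" and "continuous_on S (\<lambda>t. f t x)"
proof -
  show "continuous_on A (f t)" if "t \<in> S"
  proof -
    have "continuous_on A ((\<lambda>(t, x). f t x) \<circ> (\<lambda>x. (t, x)))"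
      by (rule continuous_on_compose) (use that in \<open>auto intro!: continuous_intros continuous_on_subset[OF assms]\<close>)
    then show ?thesis by (simp add: o_def)
  qed
  have "continuous_on S ((\<lambda>(t, x). f t x) \<circ> (\<lambda>t. (t, x)))"
    by (rule continuous_on_compose) (auto intro!: continuous_intros continuous_on_subset[OF assms])
  then show "continuous_on S (\<lambda>t. f t x)" by (simp add: o_def)
qed

lemma continuous_on_partial_integral:
  fixes f :: "real \<Rightarrow> real \<Rightarrow> real"
  assumes "continuous_on (S \<times> UNIV) (\<lambda>(t, x). f t x)"
  shows "continuous_on S (\<lambda>t. integral {a..b} (f t))"
  using integral_continuous_on_param[of S a b f] continuous_on_subset[OF assms, of "S \<times> cbox a b"]
  by auto

text \<open>For \<open>t > 0\<close>, differentiation under the integral sign gives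
\<open>d/dt \<integral>U dx = \<integral>u dx = \<integral>S dx - (V(t,b) - V(t,a))\<close>. The right-hand side is continuous up to
\<open>t = 0\<close> even where \<open>u\<close> and \<open>v\<close> are not, so the fundamental theorem of calculus applies on
\<open>[0,T]\<close>.\<close>

lemma balance_law:
  fixes U u V v S :: "real \<Rightarrow> real \<Rightarrow> real"
  assumes "0 \<le> T" "a \<le> b"
    and U: "continuous_on half_plane (\<lambda>(t, x). U t x)"
    and u: "continuous_on open_half_plane (\<lambda>(t, x). u t x)"
    and V: "continuous_on half_plane (\<lambda>(t, x). V t x)"
    and S: "continuous_on half_plane (\<lambda>(t, x). S t x)"
    and DU: "\<And>t x. t > 0 \<Longrightarrow> ((\<lambda>s. U s x) has_real_derivative u t x) (at t)"
    and DV: "\<And>t x. t > 0 \<Longrightarrow> (V t has_real_derivative v t x) (at x)"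
    and eq: "\<And>t x. t > 0 \<Longrightarrow> u t x + v t x = S t x"
  shows "integral {a..b} (U T) - integral {a..b} (U 0) + integral {0..T} (\<lambda>t. V t b - V t a)
       = integral {0..T} (\<lambda>t. integral {a..b} (S t))"
proof -
  let ?G = "\<lambda>t. integral {a..b} (U t)"
  let ?H = "\<lambda>t. integral {a..b} (S t) - (V t b - V t a)"
  have sub: "{0..T} \<times> UNIV \<subseteq> half_plane" by auto
  have contG: "continuous_on {0..T} ?G" and contS: "continuous_on {0..T} (\<lambda>t. integral {a..b} (S t))"
    by (intro continuous_on_partial_integral continuous_on_subset[OF U sub] continuous_on_subset[OF S sub])+
  have contV: "continuous_on {0..T} (\<lambda>t. V t b - V t a)"
    by (intro continuous_intros continuous_on_slices(2) continuous_on_subset[OF V sub])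
  have "(?G has_real_derivative ?H t) (at t)" if "t > 0" for t
  proof -
    have "(?G has_real_derivative integral (cbox a b) (u t)) (at t within {0<..})"
      unfolding box_real(2)[symmetric]
    proof (rule leibniz_rule_field_derivative)
      show "U s integrable_on cbox a b" if "s \<in> {0<..}" for s
        using that by (auto intro!: integrable_continuous_real continuous_on_slices(1)[OF U])
      show "continuous_on ({0<..} \<times> cbox a b) (\<lambda>(t, x). u t x)"
        by (rule continuous_on_subset[OF u]) auto
    qed (use that in \<open>auto intro: DU has_field_derivative_at_within\<close>)
    then have "(?G has_real_derivative integral {a..b} (u t)) (at t)"
      using that by (simp add: at_within_open[OF _ open_greaterThan])
    moreover have "integral {a..b} (u t) = ?H t"
    proof -
      have "(v t has_integral (V t b - V t a)) {a..b}"
        using DV[OF that] \<open>a \<le> b\<close>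
        by (intro fundamental_theorem_of_calculus)
          (auto intro: has_field_derivative_at_within simp: has_real_derivative_iff_has_vector_derivative[symmetric])
      moreover have "(S t has_integral integral {a..b} (S t)) {a..b}"
        using that by (intro integrable_integral integrable_continuous_real continuous_on_slices(1)[OF S]) auto
      ultimately have "((\<lambda>x. S t x - v t x) has_integral ?H t) {a..b}"
        by (intro has_integral_diff)
      moreover have "(\<lambda>x. S t x - v t x) = u t" using eq[OF that] by (auto simp: fun_eq_iff algebra_simps)
      ultimately show ?thesis by (simp add: integral_unique)
    qed
    ultimately show ?thesis by simp
  qed
  then have "(?H has_integral ?G T - ?G 0) {0..T}"
    using \<open>0 \<le> T\<close> contG
    by (intro fundamental_theorem_of_calculus_interior) (auto simp: has_real_derivative_iff_has_vector_derivative)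
  then have "integral {0..T} ?H = ?G T - ?G 0" by (rule integral_unique)
  moreover have "integral {0..T} ?H = integral {0..T} (\<lambda>t. integral {a..b} (S t)) - integral {0..T} (\<lambda>t. V t b - V t a)"
    by (intro Henstock_Kurzweil_Integration.integral_diff integrable_continuous_real contS contV)
  ultimately show ?thesis by simp
qed

lemma integral_symmetric_intervals_tendsto:
  fixes f :: "real \<Rightarrow> real"
  assumes "integrable lebesgue f"
  shows "(\<lambda>n. integral {- real n..real n} f) \<longlonglongrightarrow> (LINT x|lebesgue. f x)"
proof -
  have "set_integrable lebesgue {- real n..real n} f" for n
    unfolding set_integrable_def using assms by (intro integrable_mult_indicator) auto
  then have eq: "integral {- real n..real n} f = (LINT x|lebesgue. indicator {- real n..real n} x *\<^sub>R f x)" for n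
    by (simp add: set_lebesgue_integral_eq_integral(2)[symmetric] set_lebesgue_integral_def)
  show ?thesis
    unfolding eq
  proof (rule integral_dominated_convergence[where w = "\<lambda>x. \<bar>f x\<bar>"])
    show "AE x in lebesgue. (\<lambda>n. indicator {- real n..real n} x *\<^sub>R f x) \<longlonglongrightarrow> f x"
    proof (rule AE_I2)
      fix x :: real
      obtain N :: nat where N: "\<bar>x\<bar> \<le> real N" using real_arch_simple by blast
      have "indicator {- real n..real n} x *\<^sub>R f x = f x" if "n \<ge> N" for n
      proof -
        have "\<bar>x\<bar> \<le> real n" using N that by linarith
        then show ?thesis by (simp add: indicator_def abs_le_iff)
      qed
      then have "\<forall>\<^sub>F n in sequentially. indicator {- real n..real n} x *\<^sub>R f x = f x"
        using eventually_sequentially by blast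
      then show "(\<lambda>n. indicator {- real n..real n} x *\<^sub>R f x) \<longlonglongrightarrow> f x"
        by (rule tendsto_eventually)
    qed
    show "(\<lambda>x. indicator {- real n..real n} x *\<^sub>R f x) \<in> borel_measurable lebesgue" for n
      using assms by (intro borel_measurable_scaleR borel_measurable_indicator borel_measurable_integrable) auto
  qed (use assms in \<open>auto simp: indicator_def\<close>)
qed

text \<open>The balance law on \<open>[0,T] \<times> [-n,n]\<close> in the limit of large \<open>n\<close>. The boundary terms tend to \<open>0\<close>
for each \<open>t\<close> and are dominated by \<open>2K\<close>, hence so does their time integral.\<close>

lemma integral_mono_of_dissipative_balance_law:
  fixes U u V v S :: "real \<Rightarrow> real \<Rightarrow> real"
  assumes "0 \<le> T"
    and U: "continuous_on half_plane (\<lambda>(t, x). U t x)"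
    and u: "continuous_on open_half_plane (\<lambda>(t, x). u t x)"
    and V: "continuous_on half_plane (\<lambda>(t, x). V t x)"
    and S: "continuous_on half_plane (\<lambda>(t, x). S t x)"
    and DU: "\<And>t x. t > 0 \<Longrightarrow> ((\<lambda>s. U s x) has_real_derivative u t x) (at t)"
    and DV: "\<And>t x. t > 0 \<Longrightarrow> (V t has_real_derivative v t x) (at x)"
    and eq: "\<And>t x. t > 0 \<Longrightarrow> u t x + v t x = S t x"
    and S_le: "\<And>t x. t \<ge> 0 \<Longrightarrow> S t x \<le> 0"
    and int: "integrable lebesgue (U T)" "integrable lebesgue (U 0)"
    and bound: "\<And>t x. t \<ge> 0 \<Longrightarrow> \<bar>V t x\<bar> \<le> K"
    and lim: "\<And>t. t \<ge> 0 \<Longrightarrow> (V t \<longlongrightarrow> 0) at_top" "\<And>t. t \<ge> 0 \<Longrightarrow> (V t \<longlongrightarrow> 0) at_bot"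
  shows "(LINT x|lebesgue. U T x) \<le> (LINT x|lebesgue. U 0 x)"
proof -
  let ?I = "\<lambda>n::nat. integral {0..T} (\<lambda>t. V t n - V t (- n))"
  have sub: "{0..T} \<times> UNIV \<subseteq> half_plane" by auto
  have "?I \<longlonglongrightarrow> integral {0..T} (\<lambda>t. 0)"
  proof (rule dominated_convergence[where h = "\<lambda>_. 2 * K"])
    show "(\<lambda>t. V t (real n) - V t (- real n)) integrable_on {0..T}" for n
      by (intro integrable_continuous_real continuous_intros continuous_on_slices(2) continuous_on_subset[OF V sub])
    show "norm (V t (real n) - V t (- real n)) \<le> 2 * K" if "t \<in> {0..T}" for n t
      using bound[of t "real n"] bound[of t "- real n"] that by auto
    show "(\<lambda>n. V t (real n) - V t (- real n)) \<longlonglongrightarrow> 0" if "t \<in> {0..T}" for t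
    proof -
      have "filterlim (\<lambda>n. - real n) at_bot sequentially"
        using filterlim_real_sequentially by (simp add: filterlim_uminus_at_bot)
      then have "(\<lambda>n. V t (- real n)) \<longlonglongrightarrow> 0" "(\<lambda>n. V t (real n)) \<longlonglongrightarrow> 0"
        using that filterlim_compose[OF lim(1) filterlim_real_sequentially] filterlim_compose[OF lim(2)] by auto
      then show ?thesis by (auto intro: tendsto_eq_intros)
    qed
  qed auto
  then have "(\<lambda>n. integral {- real n..real n} (U T) - integral {- real n..real n} (U 0) + ?I n)
      \<longlonglongrightarrow> (LINT x|lebesgue. U T x) - (LINT x|lebesgue. U 0 x) + 0"
    by (intro tendsto_intros integral_symmetric_intervals_tendsto int) simp
  moreover have "integral {- real n..real n} (U T) - integral {- real n..real n} (U 0) + ?I n \<le> 0" for n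
  proof -
    have "integral {0..T} (\<lambda>t. integral {- real n..real n} (S t)) \<le> integral {0..T} (\<lambda>t. 0)"
    proof (rule integral_le)
      show "(\<lambda>t. integral {- real n..real n} (S t)) integrable_on {0..T}"
        by (intro integrable_continuous_real continuous_on_partial_integral continuous_on_subset[OF S sub])
      show "integral {- real n..real n} (S t) \<le> 0" if "t \<in> {0..T}" for t
      proof -
        have "S t integrable_on {- real n..real n}"
          using that by (intro integrable_continuous_real continuous_on_slices(1)[OF S]) auto
        then have "integral {- real n..real n} (S t) \<le> integral {- real n..real n} (\<lambda>_. 0)"
          using that S_le by (intro integral_le) auto
        then show ?thesis by simp
      qed
    qed auto
    then show ?thesis
      using balance_law[OF \<open>0 \<le> T\<close> _ U u V S DU DV eq, of "- real n" "real n"] by simp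
  qed
  ultimately show ?thesis
    using LIMSEQ_le_const2[of _ _ 0] by fastforce
qed

section \<open>Bump functions and the fundamental lemma of the calculus of variations\<close>

definition C2 :: "(real \<Rightarrow> real) \<Rightarrow> bool" where
  "C2 f \<longleftrightarrow> (\<exists>f' f''. (\<forall>x. (f has_real_derivative f' x) (at x)) \<and>
     (\<forall>x. (f' has_real_derivative f'' x) (at x)) \<and> continuous_on UNIV f'')"

lemma DERIV_everywhere_continuous:
  "(\<And>x. (f has_real_derivative f' x) (at x)) \<Longrightarrow> continuous_on S f"
  by (meson DERIV_atLeastAtMost_imp_continuous_on DERIV_isCont continuous_at_imp_continuous_on)

lemma C2E:
  assumes "C2 f"
  obtains f' f'' where "\<And>x. (f has_real_derivative f' x) (at x)"
    "\<And>x. (f' has_real_derivative f'' x) (at x)"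
    "continuous_on UNIV f" "continuous_on UNIV f'" "continuous_on UNIV f''"
  using assms unfolding C2_def by (metis DERIV_everywhere_continuous)

lemma C2_const: "C2 (\<lambda>x. c)"
  unfolding C2_def by (intro exI[of _ "\<lambda>_. 0"]) auto

lemma C2_mult:
  assumes "C2 f" "C2 g"
  shows "C2 (\<lambda>x. f x * g x)"
proof -
  obtain f' f'' where f: "\<And>x. (f has_real_derivative f' x) (at x)"
    "\<And>x. (f' has_real_derivative f'' x) (at x)"
    "continuous_on UNIV f" "continuous_on UNIV f'" "continuous_on UNIV f''" using C2E[OF assms(1)] by blast
  obtain g' g'' where g: "\<And>x. (g has_real_derivative g' x) (at x)"
    "\<And>x. (g' has_real_derivative g'' x) (at x)"
    "continuous_on UNIV g" "continuous_on UNIV g'" "continuous_on UNIV g''" using C2E[OF assms(2)] by blast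
  show ?thesis
    unfolding C2_def
    by (rule exI[of _ "\<lambda>x. f' x * g x + g' x * f x"],
        rule exI[of _ "\<lambda>x. f'' x * g x + 2 * f' x * g' x + g'' x * f x"])
      (auto intro!: derivative_eq_intros f g continuous_intros simp: algebra_simps)
qed

lemma C2_power: "C2 f \<Longrightarrow> C2 (\<lambda>x. f x ^ k)"
proof (induction k)
  case 0
  show ?case using C2_const[of 1] by simp
next
  case (Suc k)
  then show ?case using C2_mult[of f "\<lambda>x. f x ^ k"] by simp
qed

lemma C2_affine:
  assumes "C2 f"
  shows "C2 (\<lambda>x. f (a * x + b))"
proof -
  obtain f' f'' where f: "\<And>x. (f has_real_derivative f' x) (at x)"
    "\<And>x. (f' has_real_derivative f'' x) (at x)"
    "continuous_on UNIV f" "continuous_on UNIV f'" "continuous_on UNIV f''" using C2E[OF assms(1)] by blast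
  have chain: "((\<lambda>x. F (a * x + b)) has_real_derivative F' (a * x + b) * a) (at x)"
    if "\<And>x. (F has_real_derivative F' x) (at x)" for F F' x
    by (rule DERIV_chain2[OF that]) (auto intro!: derivative_eq_intros)
  have "continuous_on UNIV (\<lambda>x. f'' (a * x + b))"
    by (rule continuous_on_compose2[OF f(5)]) (auto intro!: continuous_intros)
  then show ?thesis
    unfolding C2_def using chain[OF f(1)] DERIV_cmult_right[OF chain[OF f(2)]]
    by (intro exI[of _ "\<lambda>x. f' (a * x + b) * a"] exI[of _ "\<lambda>x. (f'' (a * x + b) * a) * a"])
      (auto intro: continuous_on_mult_right)
qed

lemma C2_fraction:
  assumes "C2 f" and pos: "\<And>x. f x \<ge> 0"
  shows "C2 (\<lambda>x. f x / (1 + f x))"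
proof -
  obtain f' f'' where f: "\<And>x. (f has_real_derivative f' x) (at x)"
    "\<And>x. (f' has_real_derivative f'' x) (at x)"
    "continuous_on UNIV f" "continuous_on UNIV f'" "continuous_on UNIV f''" using C2E[OF assms(1)] by blast
  have nz: "1 + f x \<noteq> 0" for x using pos[of x] by linarith
  show ?thesis
    unfolding C2_def
  proof (rule exI[of _ "\<lambda>x. f' x / (1 + f x)^2"],
      rule exI[of _ "\<lambda>x. (f'' x * (1 + f x) - 2 * f' x ^ 2) / (1 + f x)^3"], intro conjI allI)
    show "((\<lambda>x. f x / (1 + f x)) has_real_derivative f' x / (1 + f x)^2) (at x)" for x
      using nz[of x] by (auto intro!: derivative_eq_intros f simp: divide_simps power2_eq_square) (simp add: algebra_simps)?
    have "((\<lambda>x. f' x / (1 + f x)^2) has_real_derivative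
       (f'' x * (1 + f x)^2 - f' x * (2 * (1 + f x) * f' x)) / ((1 + f x)^2 * (1 + f x)^2)) (at x)" for x
      using nz[of x] by (auto intro!: derivative_eq_intros f)
    moreover have "(f'' x * (1 + f x)^2 - f' x * (2 * (1 + f x) * f' x)) / ((1 + f x)^2 * (1 + f x)^2) =
      (f'' x * (1 + f x) - 2 * f' x ^ 2) / (1 + f x)^3" for x
    proof -
      have "(f'' x * (1 + f x)^2 - f' x * (2 * (1 + f x) * f' x)) = (1 + f x) * (f'' x * (1 + f x) - 2 * f' x ^ 2)"
        "(1 + f x)^2 * (1 + f x)^2 = (1 + f x) * (1 + f x)^3"
        by (simp_all add: algebra_simps power2_eq_square power3_eq_cube)
      then show "(f'' x * (1 + f x)^2 - f' x * (2 * (1 + f x) * f' x)) / ((1 + f x)^2 * (1 + f x)^2) =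
        (f'' x * (1 + f x) - 2 * f' x ^ 2) / (1 + f x)^3" using nz[of x] by simp
    qed
    ultimately show "((\<lambda>x. f' x / (1 + f x)^2) has_real_derivative
       (f'' x * (1 + f x) - 2 * f' x ^ 2) / (1 + f x)^3) (at x)" for x
      by simp
    show "continuous_on UNIV (\<lambda>x. (f'' x * (1 + f x) - 2 * f' x ^ 2) / (1 + f x)^3)"
      using nz by (intro continuous_intros f) auto
  qed
qed

text \<open>Away from \<open>0\<close> the function is locally a polynomial; at \<open>0\<close> the difference quotient is bounded
by \<open>\<bar>h\<bar>^n\<close>.\<close>

lemma DERIV_pos_part_power:
  assumes "n \<ge> 1"
  shows "((\<lambda>x::real. max 0 x ^ Suc n) has_real_derivative real (Suc n) * max 0 x ^ n) (at x)"
proof -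
  consider "x > 0" | "x < 0" | "x = 0" by linarith
  then show ?thesis
  proof cases
    case 1
    have "((\<lambda>x::real. x ^ Suc n) has_real_derivative real (Suc n) * max 0 x ^ n) (at x)"
      using 1 DERIV_pow[of "Suc n" x] by (simp add: max_def)
    then show ?thesis
      by (rule has_field_derivative_transform_within_open[of _ _ _ "{0<..}"]) (use 1 in auto)
  next
    case 2
    have "((\<lambda>x::real. 0) has_real_derivative real (Suc n) * max 0 x ^ n) (at x)"
      using 2 assms by (auto intro!: derivative_eq_intros simp: max_def)
    then show ?thesis
      by (rule has_field_derivative_transform_within_open[of _ _ _ "{..<0}"]) (use 2 in auto)
  next
    case 3
    have "((\<lambda>h::real. max 0 h ^ Suc n / h) \<longlongrightarrow> 0) (at 0)"
    proof (rule Lim_null_comparison)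
      show "\<forall>\<^sub>F h::real in at 0. norm (max 0 h ^ Suc n / h) \<le> \<bar>h\<bar> ^ n"
        by (auto simp: eventually_at_filter max_def intro!: always_eventually)
      show "((\<lambda>h::real. \<bar>h\<bar> ^ n) \<longlongrightarrow> 0) (at 0)"
        using assms by (auto intro!: tendsto_eq_intros)
    qed
    then show ?thesis using 3 assms by (simp add: DERIV_def zero_power del: power_Suc)
  qed
qed

lemma C2_pos_part_cube: "C2 (\<lambda>x. max 0 x ^ 3)"
proof -
  have "((\<lambda>x::real. max 0 x ^ 3) has_real_derivative 3 * max 0 x ^ 2) (at x)" for x
    using DERIV_pos_part_power[of 2 x] by (simp add: eval_nat_numeral)
  moreover have "((\<lambda>x::real. 3 * max 0 x ^ 2) has_real_derivative 3 * (2 * max 0 x)) (at x)" for x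
    using DERIV_cmult[OF DERIV_pos_part_power[of 1 x], of 3] by (simp add: eval_nat_numeral)
  ultimately show ?thesis
    unfolding C2_def
    by (intro exI[of _ "\<lambda>x. 3 * max 0 x ^ 2"] exI[of _ "\<lambda>x. 3 * (2 * max 0 x)"])
      (auto intro!: continuous_intros)
qed

text \<open>A twice continuously differentiable function that is positive exactly on \<open>(p,q)\<close> when \<open>n > 0\<close>,
built as \<open>nB/(1+nB)\<close> from \<open>B = (x-p)_+^3 (q-x)_+^3\<close>. It takes values in \<open>[0,1]\<close> and tends to
the indicator of \<open>(p,q)\<close> as \<open>n \<rightarrow> \<infinity>\<close>.\<close>

definition bump :: "real \<Rightarrow> real \<Rightarrow> nat \<Rightarrow> real \<Rightarrow> real" where
  "bump p q n x = (let B = real n * (max 0 (x - p) ^ 3 * max 0 (q - x) ^ 3) in B / (1 + B))"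

lemma C2_bump: "C2 (bump p q n)"
proof -
  have "C2 (\<lambda>x. real n * (max 0 (1 * x + - p) ^ 3 * max 0 (- 1 * x + q) ^ 3))"
    by (intro C2_mult C2_const C2_affine[OF C2_pos_part_cube])
  then have "C2 (\<lambda>x. real n * (max 0 (x - p) ^ 3 * max 0 (q - x) ^ 3))"
    by (simp add: algebra_simps)
  from C2_fraction[OF this] show ?thesis
    by (simp add: bump_def[abs_def] Let_def)
qed

lemma bump_bounds: "0 \<le> bump p q n x" "bump p q n x \<le> 1"
proof -
  have "0 \<le> B / (1 + B) \<and> B / (1 + B) \<le> 1" if "B \<ge> 0" for B :: real
    using that by simp
  moreover have "0 \<le> real n * (max 0 (x - p) ^ 3 * max 0 (q - x) ^ 3)"
    by (intro mult_nonneg_nonneg zero_le_power) auto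
  ultimately show "0 \<le> bump p q n x" "bump p q n x \<le> 1"
    unfolding bump_def Let_def by blast+
qed

lemma bump_outside: "x \<notin> {p<..<q} \<Longrightarrow> bump p q n x = 0"
  by (auto simp: bump_def Let_def max_def)

lemma bump_pos: "p < x \<Longrightarrow> x < q \<Longrightarrow> 0 < n \<Longrightarrow> 0 < bump p q n x"
proof -
  assume "p < x" "x < q" "0 < n"
  then have "real n * (max 0 (x - p) ^ 3 * max 0 (q - x) ^ 3) > 0"
    by (intro mult_pos_pos zero_less_power) auto
  then show ?thesis by (simp add: bump_def Let_def)
qed

lemma bump_tendsto_indicator: "(\<lambda>n. bump p q n x) \<longlonglongrightarrow> indicator {p<..<q} x"
proof (cases "x \<in> {p<..<q}")
  case True
  define B where "B = max 0 (x - p) ^ 3 * max 0 (q - x) ^ 3"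
  have "B > 0" using True by (auto simp: B_def)
  have "(\<lambda>n. 1 - 1 / (1 + real n * B)) \<longlonglongrightarrow> 1 - 0"
    using \<open>B > 0\<close> by real_asymp
  moreover have "bump p q n x = 1 - 1 / (1 + real n * B)" for n
  proof -
    have "1 + real n * B > 0" using \<open>B > 0\<close> by (intro add_pos_nonneg) auto
    then show ?thesis by (simp add: bump_def Let_def B_def[symmetric] divide_simps)
  qed
  ultimately show ?thesis using True by simp
qed (simp add: bump_outside)

text \<open>The first factor localises to \<open>S\<close>; the second factor, a bump on an arbitrary rational interval,
serves to approximate the indicator of that interval, and \<open>k = 0\<close> switches it off. Rational
endpoints keep the family countable. Pairs with \<open>p \<ge> q\<close> contribute only the zero function.\<close>

definition bumps :: "real set \<Rightarrow> (real \<Rightarrow> real) set" where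
  "bumps S = (\<lambda>(p, q, a, b, n, k) x. bump p q 1 x * bump a b n x ^ k) `
     {(p, q, a, b, n, k). {p, q, a, b} \<subseteq> \<rat> \<and> {p..q} \<subseteq> S}"

lemma countable_bumps: "countable (bumps S)"
proof -
  have "{(p, q, a, b, n::nat, k::nat). {p, q, a, b} \<subseteq> \<rat> \<and> {p..q} \<subseteq> S} \<subseteq> \<rat> \<times> \<rat> \<times> \<rat> \<times> \<rat> \<times> UNIV \<times> UNIV"
    by auto
  then have "countable {(p, q, a, b, n::nat, k::nat). {p, q, a, b} \<subseteq> \<rat> \<and> {p..q} \<subseteq> S}"
    by (rule countable_subset) (auto intro!: countable_SIGMA simp: countable_rat)
  then show ?thesis unfolding bumps_def by (rule countable_image)
qed

lemma C2_bumps: "\<psi> \<in> bumps S \<Longrightarrow> C2 \<psi>"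
  unfolding bumps_def by clarify (intro C2_mult C2_power C2_bump)

lemma bumps_support:
  assumes "\<psi> \<in> bumps S"
  obtains p q where "p < q" "{p..q} \<subseteq> S" "\<And>x. x \<notin> {p<..<q} \<Longrightarrow> \<psi> x = 0" | "\<And>x. \<psi> x = 0"
proof -
  obtain p q a b n k where *: "{p..q} \<subseteq> S" "\<psi> = (\<lambda>x. bump p q 1 x * bump a b n x ^ k)"
    using assms by (auto simp: bumps_def)
  show thesis
  proof (cases "p < q")
    case True
    then show thesis using * by (intro that(1)[of p q]) (auto simp: bump_outside)
  next
    case False
    then show thesis using * by (intro that(2)) (auto simp: bump_outside)
  qed
qed

lemma bumps_bound:
  assumes "\<psi> \<in> bumps S"
  shows "\<bar>\<psi> x\<bar> \<le> 1"
proof -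
  obtain p q a b n k where "\<psi> x = bump p q 1 x * bump a b n x ^ k"
    using assms by (auto simp: bumps_def)
  then show ?thesis
    using bump_bounds[of p q 1 x] bump_bounds[of a b n x]
    by (simp add: abs_mult power_abs mult_le_one power_le_one)
qed

text \<open>By dominated convergence the integrals over all half-open intervals and over the line vanish as
well; these intervals form a generator of the Borel sets that is stable under intersections, so
the integral over every Borel set vanishes.\<close>

lemma AE_zero_if_rational_interval_integrals_zero:
  fixes g :: "real \<Rightarrow> real"
  assumes g: "integrable lebesgue g"
    and zero: "\<And>a b. a \<in> \<rat> \<Longrightarrow> b \<in> \<rat> \<Longrightarrow> (LINT x|lebesgue. indicator {a<..<b} x * g x) = 0"
  shows "AE x in lebesgue. g x = 0"
proof -
  obtain f where f: "f \<in> borel_measurable lborel" and fg: "AE x in lborel. g x = f x"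
    using completion_ex_borel_measurable_real[OF borel_measurable_integrable[OF g]] by blast
  have fg': "AE x in lebesgue. f x = g x" using AE_completion[OF fg] by auto
  have "integrable lebesgue f" using lebesgue_integrable_cong_AE[OF fg'] g by simp
  then have intf: "integrable lborel f" using f by (simp add: integrable_completion)
  have eq: "(LINT x:A|lborel. f x) = (LINT x|lebesgue. indicator A x * g x)" if "A \<in> sets borel" for A
  proof -
    have "(LINT x:A|lborel. f x) = (LINT x|lebesgue. indicator A x * f x)"
      unfolding set_lebesgue_integral_def using that f by (subst integral_completion) auto
    also have "\<dots> = (LINT x|lebesgue. indicator A x * g x)"
      using fg' by (intro lebesgue_integral_cong_AE) (auto elim: eventually_mono)
    finally show ?thesis .
  qed
  have si: "set_integrable lborel A f" if "A \<in> sets borel" for A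
    unfolding set_integrable_def using that by (intro integrable_mult_indicator intf) auto
  have lim0: "(LINT x:A|lborel. f x) = 0"
    if A: "A \<in> sets borel" and I: "\<And>x. (\<lambda>n. indicat_real {a n<..<b n} x) \<longlonglongrightarrow> indicator A x"
      and ab: "\<And>n. a n \<in> \<rat>" "\<And>n. b n \<in> \<rat>" for A a b
  proof -
    have "(\<lambda>n. LINT x:{a n<..<b n}|lborel. f x) \<longlonglongrightarrow> (LINT x:A|lborel. f x)"
      unfolding set_lebesgue_integral_def
    proof (rule integral_dominated_convergence[where w = "\<lambda>x. \<bar>f x\<bar>"])
      show "AE x in lborel. (\<lambda>n. indicat_real {a n<..<b n} x *\<^sub>R f x) \<longlonglongrightarrow> indicat_real A x *\<^sub>R f x"
        using I by (intro AE_I2 tendsto_intros) auto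
    qed (use f A intf in \<open>auto simp: indicator_def\<close>)
    moreover have "(LINT x:{a n<..<b n}|lborel. f x) = 0" for n
      using eq[of "{a n<..<b n}"] zero ab by simp
    ultimately show ?thesis by (simp add: LIMSEQ_const_iff)
  qed
  have univ: "(LINT x:UNIV|lborel. f x) = 0"
  proof (rule lim0[where a = "\<lambda>n. - real n" and b = "\<lambda>n. real n"])
    show "(\<lambda>n. indicat_real {- real n<..<real n} x) \<longlonglongrightarrow> indicator UNIV x" for x
    proof -
      obtain N :: nat where N: "\<bar>x\<bar> < real N" using reals_Archimedean2 by blast
      have "indicat_real {- real n<..<real n} x = 1" if "n \<ge> N" for n
        using N that by (auto simp: indicator_def)
      then show ?thesis by (intro tendsto_eventually) (auto simp: eventually_sequentially)
    qed
  qed auto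
  have Ioc: "(LINT x:{a<..b}|lborel. f x) = 0" for a b
  proof -
    have ex: "\<exists>r\<in>\<rat>. c < r \<and> r < c + 1 / Suc n" for c :: real and n :: nat
      using Rats_dense_in_real[of c "c + 1 / Suc n"] by auto
    \<comment> \<open>Rational sequences tending to \<open>a\<close> and \<open>b\<close> from strictly above: the open intervals then converge to \<open>(a,b]\<close>.\<close>
    obtain A where A: "\<And>n. A n \<in> \<rat>" "\<And>n. a < A n" "\<And>n. A n < a + 1 / Suc n"
      using ex[of a] by metis
    obtain B where B: "\<And>n. B n \<in> \<rat>" "\<And>n. b < B n" "\<And>n. B n < b + 1 / Suc n"
      using ex[of b] by metis
    have limc: "(\<lambda>n. c + 1 / Suc n) \<longlonglongrightarrow> c" for c :: real
      by real_asymp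
    have limA: "A \<longlonglongrightarrow> a"
      by (rule tendsto_sandwich[OF _ _ tendsto_const limc]) (use A in \<open>auto intro!: always_eventually less_imp_le\<close>)
    have limB: "B \<longlonglongrightarrow> b"
      by (rule tendsto_sandwich[OF _ _ tendsto_const limc]) (use B in \<open>auto intro!: always_eventually less_imp_le\<close>)
    show ?thesis
    proof (rule lim0[where a = A and b = B])
      show "(\<lambda>n. indicat_real {A n<..<B n} x) \<longlonglongrightarrow> indicator {a<..b} x" for x
      proof -
        consider "x \<le> a" | "x > b" | "a < x" "x \<le> b" by linarith
        then show ?thesis
        proof cases
          case 1
          then have "indicat_real {A n<..<B n} x = indicator {a<..b} x" for n
            using A(2)[of n] by (auto simp: indicator_def)
          then show ?thesis by simp
        next
          case 2
          have "\<forall>\<^sub>F n in sequentially. B n < x" using order_tendstoD(2)[OF limB 2] .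
          then show ?thesis
            by (intro tendsto_eventually) (use 2 in \<open>auto elim!: eventually_mono simp: indicator_def\<close>)
        next
          case 3
          have "\<forall>\<^sub>F n in sequentially. A n < x" using order_tendstoD(2)[OF limA 3(1)] .
          then show ?thesis
            by (intro tendsto_eventually) 
              (use 3 le_less_trans[OF 3(2) B(2)] in \<open>auto elim!: eventually_mono simp: indicator_def\<close>)
        qed
      qed
    qed (use A B in auto)
  qed
  have "(LINT x:A|lborel. f x) = 0" if "A \<in> sets borel" for A
  proof -
    let ?E = "range (\<lambda>(a, b). {a<..b::real})"
    have st: "Int_stable ?E"
      by (auto simp: Int_stable_def)
    have sub: "?E \<subseteq> Pow UNIV" by simp
    have sb: "sets borel = sigma_sets UNIV ?E"
      unfolding borel_sigma_sets_Ioc by simp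
    have "A \<in> sigma_sets UNIV ?E" using that sb by simp
    from st sub this show ?thesis
    proof (induction rule: sigma_sets_induct_disjoint)
      case (basic A) then show ?case using Ioc by auto
    next
      case empty then show ?case by (simp add: set_lebesgue_integral_def)
    next
      case (compl A)
      have A: "A \<in> sets borel" using compl(1) unfolding sb .
      then have A': "UNIV - A \<in> sets borel" by measurable
      have "(LINT x:A \<union> (UNIV - A)|lborel. f x) = (LINT x:A|lborel. f x) + (LINT x:UNIV - A|lborel. f x)"
        by (intro set_integral_Un si A A') blast
      moreover have "A \<union> (UNIV - A) = UNIV" by blast
      ultimately have "(LINT x:UNIV|lborel. f x) = (LINT x:A|lborel. f x) + (LINT x:UNIV - A|lborel. f x)"
        by (simp only:)
      then show ?case unfolding univ compl(2) by simp
    next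
      case (union A)
      have A: "A i \<in> sets borel" for i using union(2) unfolding sb by blast
      have "(LINT x:(\<Union>i. A i)|lborel. f x) = (\<Sum>i. (LINT x:A i|lborel. f x))"
      proof (rule lebesgue_integral_countable_add)
        show "i \<noteq> j \<Longrightarrow> A i \<inter> A j = {}" for i j using union(1) by (auto simp: disjoint_family_on_def)
      qed (use A in \<open>auto intro!: si\<close>)
      then show ?case using union(3) by simp
    qed
  qed
  then have "AE x in lborel. f x = 0"
    using density_unique_real[OF intf integrable_zero] by (simp add: set_lebesgue_integral_def)
  then have "AE x in lebesgue. f x = 0" by (rule AE_completion)
  with fg' show ?thesis by eventually_elim simp
qed

text \<open>The fundamental lemma of the calculus of variations for a countable family of test functions.
With \<open>g = bump p q 1 * G\<close>, which is integrable, the bumps on \<open>(a,b)\<close> converge boundedly to the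
indicator of \<open>(a,b)\<close>, so \<open>g\<close> has vanishing integral over every rational interval and is zero
almost everywhere; on \<open>(p,q)\<close> the factor can be divided out. Countability of the family is what
lets a null set that depends on the test function be replaced by a single one.\<close>

lemma AE_zero_if_bump_integrals_zero:
  fixes G :: "real \<Rightarrow> real"
  assumes "open S"
    and int: "\<And>\<psi>. \<psi> \<in> bumps S \<Longrightarrow> integrable lebesgue (\<lambda>x. \<psi> x * G x)"
    and zero: "\<And>\<psi>. \<psi> \<in> bumps S \<Longrightarrow> (LINT x|lebesgue. \<psi> x * G x) = 0"
  shows "AE x in lebesgue. x \<in> S \<longrightarrow> G x = 0"
proof -
  let ?I = "{(p, q). p \<in> \<rat> \<and> q \<in> \<rat> \<and> {p..q} \<subseteq> S}"
  have *: "AE x in lebesgue. bump p q 1 x * G x = 0" if pq: "p \<in> \<rat>" "q \<in> \<rat>" "{p..q} \<subseteq> S" for p q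
  proof (rule AE_zero_if_rational_interval_integrals_zero)
    let ?g = "\<lambda>x. bump p q 1 x * G x"
    have \<psi>: "(\<lambda>x. bump p q 1 x * bump a b n x ^ k) \<in> bumps S" if "a \<in> \<rat>" "b \<in> \<rat>" for a b n k
      unfolding bumps_def by (rule image_eqI[where x = "(p, q, a, b, n, k)"]) (use that pq in auto)
    show intg: "integrable lebesgue ?g"
      \<comment> \<open>The exponent \<open>0\<close> reduces the second factor to \<open>1\<close>.\<close>
      using int[OF \<psi>[of p q 1 0]] pq by simp
    fix a b :: real assume ab: "a \<in> \<rat>" "b \<in> \<rat>"
    have "(\<lambda>n. LINT x|lebesgue. bump a b n x * ?g x) \<longlonglongrightarrow> (LINT x|lebesgue. indicator {a<..<b} x * ?g x)"
    proof (rule integral_dominated_convergence[where w = "\<lambda>x. \<bar>?g x\<bar>"])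
      show "AE x in lebesgue. (\<lambda>n. bump a b n x * ?g x) \<longlonglongrightarrow> indicator {a<..<b} x * ?g x"
        by (intro AE_I2 tendsto_intros bump_tendsto_indicator)
      show "AE x in lebesgue. norm (bump a b n x * ?g x) \<le> \<bar>?g x\<bar>" for n
        using bump_bounds[of a b n] by (intro AE_I2) (auto simp: abs_mult intro!: mult_left_le_one_le mult_nonneg_nonneg)
      show "(\<lambda>x. bump a b n x * ?g x) \<in> borel_measurable lebesgue" for n
        using intg continuous_measurable_lebesgue C2E[OF C2_bump[of a b n]]
        by (intro borel_measurable_times borel_measurable_integrable[OF intg]) blast
      show "(\<lambda>x. indicator {a<..<b} x * ?g x) \<in> borel_measurable lebesgue"
        by (intro borel_measurable_times borel_measurable_indicator borel_measurable_integrable[OF intg]) auto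
    qed (use intg in auto)
    moreover have "(LINT x|lebesgue. bump a b n x * ?g x) = 0" for n
      using zero[OF \<psi>[of a b n 1]] ab by (simp add: mult_ac)
    ultimately show "(LINT x|lebesgue. indicator {a<..<b} x * ?g x) = 0" 
      by (simp add: LIMSEQ_const_iff)
  qed
  have "countable ?I"
    by (rule countable_subset[of _ "\<rat> \<times> \<rat>"]) (auto intro!: countable_SIGMA simp: countable_rat)
  then have "AE x in lebesgue. \<forall>(p, q)\<in>?I. bump p q 1 x * G x = 0"
    using * by (subst AE_ball_countable) auto
  then show ?thesis
  proof eventually_elim
    case (elim x)
    show ?case
    proof
      assume "x \<in> S"
      then obtain e where e: "e > 0" "ball x e \<subseteq> S" using \<open>open S\<close> open_contains_ball by blast
      obtain p where p: "p \<in> \<rat>" "x - e < p" "p < x" using Rats_dense_in_real[of "x - e" x] e by auto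
      obtain q where q: "q \<in> \<rat>" "x < q" "q < x + e" using Rats_dense_in_real[of x "x + e"] e by auto
      have "{p..q} \<subseteq> ball x e" using p q by (auto simp: dist_real_def)
      then have "(p, q) \<in> ?I" using e p q by auto
      then have "bump p q 1 x * G x = 0" using elim by fastforce
      then show "G x = 0" using bump_pos[of p x q 1] p q by simp
    qed
  qed
qed

lemma bumps_borel_measurable: "\<psi> \<in> bumps S \<Longrightarrow> \<psi> \<in> borel_measurable lebesgue"
  by (rule continuous_measurable_lebesgue) (rule C2E[OF C2_bumps])

lemma integrable_bumps_mult:
  assumes "\<psi> \<in> bumps S" "integrable lebesgue f"
  shows "integrable lebesgue (\<lambda>x. \<psi> x * f x)"
proof (rule Bochner_Integration.integrable_bound[OF assms(2)])
  show "(\<lambda>x. \<psi> x * f x) \<in> borel_measurable lebesgue"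
    by (intro borel_measurable_times bumps_borel_measurable[OF assms(1)] borel_measurable_integrable assms(2))
  show "AE x in lebesgue. norm (\<psi> x * f x) \<le> norm (f x)"
    using bumps_bound[OF assms(1)] by (intro AE_I2) (simp add: abs_mult mult_left_le_one_le)
qed

lemma integrable_bumps_mult_bounded:
  assumes \<psi>: "\<psi> \<in> bumps S" and f: "f \<in> borel_measurable lebesgue" and K: "\<And>x. \<bar>f x\<bar> \<le> K"
  shows "integrable lebesgue (\<lambda>x. \<psi> x * f x)"
proof (rule Bochner_Integration.integrable_bound)
  have "integrable lebesgue \<psi>"
  proof (rule bumps_support[OF \<psi>])
    fix p q assume *: "\<And>x. x \<notin> {p<..<q} \<Longrightarrow> \<psi> x = 0"
    have "continuous_on {p..q} \<psi>"
      by (rule C2E[OF C2_bumps[OF \<psi>]]) (auto intro: continuous_on_subset)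
    then show ?thesis by (rule lebesgue_integral_supported(1)) (use * in auto)
  next
    assume "\<And>x. \<psi> x = 0"
    then have "\<psi> = (\<lambda>x. 0)" by auto
    then show ?thesis by simp
  qed
  then show "integrable lebesgue (\<lambda>x. K * \<psi> x)" by simp
  show "(\<lambda>x. \<psi> x * f x) \<in> borel_measurable lebesgue"
    by (intro borel_measurable_times bumps_borel_measurable[OF \<psi>] f)
  show "AE x in lebesgue. norm (\<psi> x * f x) \<le> norm (K * \<psi> x)"
  proof (rule AE_I2)
    fix x
    have "\<bar>f x\<bar> \<le> \<bar>K\<bar>" using K[of x] by linarith
    from mult_right_mono[OF this abs_ge_zero[of "\<psi> x"]] show "norm (\<psi> x * f x) \<le> norm (K * \<psi> x)"
      by (simp add: abs_mult mult.commute)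
  qed
qed

lemma integrable_bumps_continuous:
  assumes c: "c \<in> bumps S" and f: "continuous_on UNIV f"
  shows "integrable lebesgue (\<lambda>x. c x * f x)"
proof (rule bumps_support[OF c])
  fix p q assume *: "\<And>x. x \<notin> {p<..<q} \<Longrightarrow> c x = 0"
  have "continuous_on {p..q} (\<lambda>x. c x * f x)"
    by (rule C2E[OF C2_bumps[OF c]]) (auto intro!: continuous_intros intro: continuous_on_subset f)
  then show ?thesis by (rule lebesgue_integral_supported(1)) (use * in auto)
qed simp

section \<open>Partial derivatives and test functions\<close>

lemma partial_derivatives:
  fixes f :: "real \<Rightarrow> real \<Rightarrow> real"
  assumes D: "((\<lambda>(t, x). f t x) has_derivative (\<lambda>v. a * fst v + c * snd v)) (at (t, x) within S \<times> UNIV)"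
  shows "t \<in> S \<Longrightarrow> (f t has_real_derivative c) (at x)"
    and "((\<lambda>s. f s x) has_real_derivative a) (at t within S)"
proof -
  show "(f t has_real_derivative c) (at x)" if "t \<in> S"
  proof -
    have "((\<lambda>y. (t, y)) has_derivative (\<lambda>v. (0, v))) (at x)"
      by (auto intro!: derivative_eq_intros)
    then have "((\<lambda>y. (\<lambda>(t, x). f t x) (t, y)) has_derivative (\<lambda>v. a * fst (0, v) + c * snd (0::real, v))) (at x)"
    proof (rule has_derivative_in_compose)
      show "((\<lambda>(t, x). f t x) has_derivative (\<lambda>v. a * fst v + c * snd v)) (at (t, x) within range (Pair t))"
        by (rule has_derivative_subset[OF D]) (use that in auto)
    qed
    then show ?thesis by (simp add: has_field_derivative_def)
  qed
  have "((\<lambda>s. (s, x)) has_derivative (\<lambda>v. (v, 0))) (at t within S)"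
    by (auto intro!: derivative_eq_intros)
  then have "((\<lambda>s. (\<lambda>(t, x). f t x) (s, x)) has_derivative (\<lambda>v. a * fst (v, 0::real) + c * snd (v, 0::real))) (at t within S)"
  proof (rule has_derivative_in_compose[where g = "\<lambda>(t, x). f t x" and f = "\<lambda>s. (s, x)"])
    show "((\<lambda>(t, x). f t x) has_derivative (\<lambda>v. a * fst v + c * snd v)) (at (t, x) within (\<lambda>s. (s, x)) ` S)"
      by (rule has_derivative_subset[OF D]) auto
  qed
  then show "((\<lambda>s. f s x) has_real_derivative a) (at t within S)"
    by (simp add: has_field_derivative_def)
qed

lemma DERIV_chain_within:
  fixes f g :: "real \<Rightarrow> real"
  assumes f: "(f has_real_derivative f') (at (g x) within A)" and g: "(g has_real_derivative g') (at x)"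
    and N: "open N" "x \<in> N" "\<And>y. y \<in> N \<Longrightarrow> g y \<in> A"
  shows "((\<lambda>y. f (g y)) has_real_derivative f' * g') (at x)"
proof -
  have "((f \<circ> g) has_real_derivative f' * g') (at x within N)"
    by (rule DERIV_image_chain[OF DERIV_subset[OF f] has_field_derivative_at_within[OF g]]) (use N in auto)
  then show ?thesis unfolding at_within_open[OF N(2,1)] o_def .
qed

text \<open>Compact support is recorded by one bound \<open>L\<close> for both variables. It exceeds the radius of a ball
containing the support by \<open>1\<close>, so that near the points with \<open>t \<ge> L\<close> or \<open>\<bar>x\<bar> \<ge> L\<close> the
test function is identically zero and its derivatives vanish too. The time derivative is only
described at positive times, where it is two-sided.\<close>

lemma test_functionE:
  assumes "test_function \<phi>"
  obtains \<phi>t \<phi>x L where "L > 0"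
    "continuous_on half_plane (\<lambda>(t, x). \<phi> t x)"
    "continuous_on half_plane (\<lambda>(t, x). \<phi>t t x)"
    "continuous_on half_plane (\<lambda>(t, x). \<phi>x t x)"
    "\<And>t x. t \<ge> 0 \<Longrightarrow> (\<phi> t has_real_derivative \<phi>x t x) (at x)"
    "\<And>t x. t > 0 \<Longrightarrow> ((\<lambda>s. \<phi> s x) has_real_derivative \<phi>t t x) (at t)"
    "\<And>t x. t \<ge> 0 \<Longrightarrow> t \<ge> L \<or> \<bar>x\<bar> \<ge> L \<Longrightarrow> \<phi> t x = 0"
    "\<And>t x. t \<ge> 0 \<Longrightarrow> t \<ge> L \<or> \<bar>x\<bar> \<ge> L \<Longrightarrow> \<phi>x t x = 0"
    "\<And>t x. t > 0 \<Longrightarrow> t \<ge> L \<or> \<bar>x\<bar> \<ge> L \<Longrightarrow> \<phi>t t x = 0"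
proof -
  let ?S = "{(t, x). (t, x) \<in> half_plane \<and> \<phi> t x \<noteq> 0}"
  obtain f1 f2 where D: "\<And>p. p \<in> half_plane \<Longrightarrow>
      ((\<lambda>(t, x). \<phi> t x) has_derivative (\<lambda>v. f1 p * fst v + f2 p * snd v)) (at p within half_plane)"
    and C1: "Ck_on 1 half_plane f1" "Ck_on 1 half_plane f2"
    using assms by (auto simp: test_function_def numeral_2_eq_2)
  have Ck1_cont: "continuous_on S f" if "Ck_on 1 S f" for S f
    using that by (auto simp: continuous_on_eq_continuous_within intro: has_derivative_continuous)
  have cont: "continuous_on half_plane (\<lambda>(t, x). \<phi> t x)"
    using D by (auto simp: continuous_on_eq_continuous_within intro: has_derivative_continuous)
  have Dx: "(\<phi> t has_real_derivative f2 (t, x)) (at x)" if "t \<ge> 0" for t x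
    using partial_derivatives(1)[OF D[of "(t, x)"]] that by auto
  have Dt: "((\<lambda>s. \<phi> s x) has_real_derivative f1 (t, x)) (at t)" if "t > 0" for t x
  proof -
    have "((\<lambda>s. \<phi> s x) has_real_derivative f1 (t, x)) (at t within {0<..})"
      by (rule DERIV_subset[OF partial_derivatives(2)[OF D[of "(t, x)"]]]) (use that in auto)
    then show ?thesis using that by (simp add: at_within_open[OF _ open_greaterThan])
  qed
  have "bounded ?S"
    using assms bounded_subset[OF compact_imp_bounded closure_subset] by (auto simp: test_function_def)
  then obtain M where M: "\<And>p. p \<in> ?S \<Longrightarrow> norm p \<le> M" unfolding bounded_iff by blast
  \<comment> \<open>The absolute value gives \<open>N \<ge> 0\<close>, so that \<open>t > N\<close> implies \<open>t > 0\<close>.\<close>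
  define N where "N = \<bar>M\<bar>"
  have zero: "\<phi> t x = 0" if "t \<ge> 0" "t > N \<or> \<bar>x\<bar> > N" for t x
  proof (rule ccontr)
    assume "\<phi> t x \<noteq> 0"
    then have "norm (t, x) \<le> N" using M[of "(t, x)"] that by (auto simp: N_def)
    then show False
      using that norm_fst_le[of t x] norm_snd_le[of x t] by auto
  qed
  have zx: "f2 (t, x) = 0" if t: "t \<ge> 0" "t > N \<or> \<bar>x\<bar> > N" for t x
  proof -
    have "((\<lambda>_. 0) has_real_derivative f2 (t, x)) (at x)"
    proof (cases "t > N")
      case True
      then have "\<phi> t = (\<lambda>_. 0)" using zero t by auto
      then show ?thesis using Dx[OF t(1), of x] by simp
    next
      case False
      have "open {x. \<bar>x\<bar> > N}" by (intro open_Collect_less continuous_intros)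
      then show ?thesis
        by (rule has_field_derivative_transform_within_open[OF Dx[OF t(1)]]) (use False t zero in auto)
    qed
    then show ?thesis using DERIV_unique[OF _ DERIV_const[of 0]] by blast
  qed
  have zt: "f1 (t, x) = 0" if t: "t > 0" "t > N \<or> \<bar>x\<bar> > N" for t x
  proof -
    have "((\<lambda>_. 0) has_real_derivative f1 (t, x)) (at t)"
    proof (cases "t > N")
      case True
      show ?thesis
        by (rule has_field_derivative_transform_within_open[OF Dt[OF t(1)], of "{N<..}"])
          (use True zero in \<open>auto simp: N_def\<close>)
    next
      case False
      show ?thesis
        by (rule has_field_derivative_transform_within_open[OF Dt[OF t(1)], of "{0<..}"])
          (use False t zero in auto)
    qed
    then show ?thesis using DERIV_unique[OF _ DERIV_const[of 0]] by blast
  qed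
  show thesis
  proof (rule that[of "N + 1" "\<lambda>t x. f1 (t, x)" "\<lambda>t x. f2 (t, x)"])
    show "0 < N + 1" by (simp add: N_def)
    show "continuous_on half_plane (\<lambda>(t, x). f1 (t, x))" "continuous_on half_plane (\<lambda>(t, x). f2 (t, x))"
      using Ck1_cont[OF C1(1)] Ck1_cont[OF C1(2)] by simp_all
  qed (use cont Dx Dt zero zx zt in \<open>force\<close>)+
qed

lemma Ck_on_product:
  assumes "C2 a" "C2 c"
  shows "Ck_on 2 S (\<lambda>(t, x). a t * c x)"
proof -
  obtain a' a'' where a: "\<And>x. (a has_real_derivative a' x) (at x)"
    "\<And>x. (a' has_real_derivative a'' x) (at x)"
    "continuous_on UNIV a" "continuous_on UNIV a'" "continuous_on UNIV a''" using C2E[OF assms(1)] by blast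
  obtain c' c'' where c: "\<And>x. (c has_real_derivative c' x) (at x)"
    "\<And>x. (c' has_real_derivative c'' x) (at x)"
    "continuous_on UNIV c" "continuous_on UNIV c'" "continuous_on UNIV c''" using C2E[OF assms(2)] by blast
  have D: "((\<lambda>(t, x). f t * g x) has_derivative (\<lambda>v. (case p of (t, x) \<Rightarrow> f' t * g x) * fst v + (case p of (t, x) \<Rightarrow> f t * g' x) * snd v)) (at p within S)"
    if f: "\<And>x. (f has_real_derivative f' x) (at x)" and g: "\<And>x. (g has_real_derivative g' x) (at x)" for f f' g g' p
  proof -
    have 1: "((\<lambda>p. f (fst p)) has_derivative (\<lambda>v. fst v * f' (fst p))) (at p within S)"
      by (rule DERIV_compose_FDERIV[OF f]) (auto intro!: derivative_eq_intros)
    have 2: "((\<lambda>p. g (snd p)) has_derivative (\<lambda>v. snd v * g' (snd p))) (at p within S)"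
      by (rule DERIV_compose_FDERIV[OF g]) (auto intro!: derivative_eq_intros)
    show ?thesis
      unfolding case_prod_unfold
      by (rule has_derivative_eq_rhs[OF has_derivative_mult[OF 1 2]]) (simp add: fun_eq_iff algebra_simps)
  qed
  have C: "continuous_on S (\<lambda>(t, x). f t * g x)" if "continuous_on UNIV f" "continuous_on UNIV g" for f g :: "real \<Rightarrow> real"
    unfolding case_prod_unfold
    by (intro continuous_intros continuous_on_compose2[OF that(1)] continuous_on_compose2[OF that(2)]) auto
  have C1: "Ck_on (Suc 0) S (\<lambda>(t, x). f t * g x)"
    if "\<And>x. (f has_real_derivative f' x) (at x)" "\<And>x. (g has_real_derivative g' x) (at x)"
      "continuous_on UNIV f" "continuous_on UNIV f'" "continuous_on UNIV g" "continuous_on UNIV g'" for f f' g g'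
    unfolding Ck_on.simps using D[OF that(1,2)] C that(3-)
    by (intro exI[of _ "\<lambda>(t, x). f' t * g x"] exI[of _ "\<lambda>(t, x). f t * g' x"]) auto
  have "Ck_on (Suc 0) S (\<lambda>(t, x). a' t * c x)" "Ck_on (Suc 0) S (\<lambda>(t, x). a t * c' x)"
    by (rule C1; fact)+
  then show ?thesis
    unfolding numeral_2_eq_2 Ck_on.simps(2)[of "Suc 0"]
    using D[OF a(1) c(1)]
    by (intro exI[of _ "\<lambda>(t, x). a' t * c x"] exI[of _ "\<lambda>(t, x). a t * c' x"] conjI ballI)
qed

lemma test_function_product:
  assumes "C2 a" "C2 c" "\<And>t. t \<notin> {p..q} \<Longrightarrow> a t = 0" "\<And>x. x \<notin> {p'..q'} \<Longrightarrow> c x = 0"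
  shows "test_function (\<lambda>t x. a t * c x)"
proof -
  have "{(t, x). (t, x) \<in> half_plane \<and> a t * c x \<noteq> 0} \<subseteq> {p..q} \<times> {p'..q'}"
    using assms(3,4) by fastforce
  then have "bounded {(t, x). (t, x) \<in> half_plane \<and> a t * c x \<noteq> 0}"
    by (rule bounded_subset[rotated]) (auto intro: bounded_Times)
  then show ?thesis
    unfolding test_function_def using Ck_on_product[OF assms(1,2)] by simp
qed

lemma product_test_function:
  assumes "a \<in> bumps S" "c \<in> bumps S'"
  shows "test_function (\<lambda>t x. a t * c x)"
proof -
  have supp: "\<exists>p q. \<forall>x. x \<notin> {p..q} \<longrightarrow> \<psi> x = 0" if \<psi>: "\<psi> \<in> bumps S" for \<psi> S
  proof (rule bumps_support[OF \<psi>])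
    fix p q assume "\<And>x. x \<notin> {p<..<q} \<Longrightarrow> \<psi> x = 0"
    then show ?thesis by (intro exI[of _ p] exI[of _ q]) auto
  qed auto
  obtain p q p' q' where "\<And>t. t \<notin> {p..q} \<Longrightarrow> a t = 0" "\<And>x. x \<notin> {p'..q'} \<Longrightarrow> c x = 0"
    using supp[OF assms(1)] supp[OF assms(2)] by blast
  then show ?thesis
    using test_function_product[OF C2_bumps[OF assms(1)] C2_bumps[OF assms(2)]] by blast
qed

section \<open>The constitutive functions\<close>

text \<open>The derivative of \<open>\<kappa>\<close> is a parameter because at the endpoint \<open>0\<close> it is one-sided, where
\<open>deriv \<kappa>\<close> would involve the unspecified values of \<open>\<kappa>\<close> on negative arguments.\<close>

locale diffusion_data =
  fixes R b :: real and \<kappa> h \<kappa>' :: "real \<Rightarrow> real"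
  assumes R: "R > 1" and b: "b > 0"
    and DERIV_\<kappa>: "\<And>r. r \<in> {0..<R} \<Longrightarrow> (\<kappa> has_real_derivative \<kappa>' r) (at r within {0..<R})"
    and continuous_\<kappa>': "continuous_on {0..<R} \<kappa>'"
    and \<kappa>_zero: "\<And>r. r \<in> {0..1} \<Longrightarrow> \<kappa> r = 0"
    and DERIV_h: "\<And>s. (h has_real_derivative deriv h s) (at s)"
    and continuous_deriv_h: "continuous_on UNIV (deriv h)"
    and h_0: "h 0 = 0" and deriv_h_pos: "\<And>s. deriv h s > 0" and range_h: "range h = {-1<..<b}"
begin

lemma continuous_\<kappa>: "continuous_on {0..<R} \<kappa>"
  by (rule DERIV_continuous_on[OF DERIV_\<kappa>])

lemma strict_mono_h: "strict_mono h"
  unfolding strict_mono_def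
  by (metis DERIV_pos_imp_increasing DERIV_h deriv_h_pos)

lemma continuous_h: "continuous_on S h"
  by (rule DERIV_everywhere_continuous[OF DERIV_h])

lemma h_bounds: "-1 < h s" "h s < b"
  using range_h rangeI[of h s] by auto

lemma inv_h: "inv h (h s) = s"
  by (simp add: strict_mono_h strict_mono_imp_inj_on)

lemma h_inv: "y \<in> {-1<..<b} \<Longrightarrow> h (inv h y) = y"
  using range_h by (metis f_inv_into_f)

lemma dissipation_sign: "y * h (- y) \<le> 0"
  using strict_mono_h h_0 by (metis linorder_le_cases mult_nonneg_nonpos mult_nonpos_nonneg neg_0_le_iff_le neg_le_0_iff_le strict_mono_less_eq)

lemma Q_eq_0: "r \<in> {0..1} \<Longrightarrow> Q \<kappa> r = 0"
proof -
  assume r: "r \<in> {0..1}"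
  have "Q \<kappa> r = (LBINT \<tau>=1..ereal r. 0)"
    unfolding Q_def one_ereal_def
    by (rule interval_integral_cong) (use r \<kappa>_zero in \<open>auto simp: einterval_def min_def max_def split: if_splits\<close>)
  then show ?thesis by simp
qed

lemma DERIV_integral_from_1:
  assumes "continuous_on {0..<R} f" "r \<in> {0..<R}"
  shows "((\<lambda>u. LBINT \<tau>=1..ereal u. f \<tau>) has_real_derivative f r) (at r within {0..<R})"
proof -
  obtain c where c: "max 1 r < c" "c < R" using assms(2) R dense[of "max 1 r" R] by auto
  have sub: "{0..c} \<subseteq> {0..<R}" using c by auto
  have "((\<lambda>u. LBINT \<tau>=ereal 1..ereal u. f \<tau>) has_vector_derivative f r) (at r within {0..c})"
    by (rule interval_integral_FTC2) (use c assms continuous_on_subset[OF assms(1) sub] in auto)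
  moreover have "at r within {0..c} = at r within {0..<R}"
    by (rule at_within_nhd[of _ "{..<c}"]) (use c in auto)
  ultimately show ?thesis
    by (simp add: has_real_derivative_iff_has_vector_derivative one_ereal_def)
qed

lemma DERIV_Q': "r \<in> {0..<R} \<Longrightarrow> (Q' \<kappa> has_real_derivative \<kappa> r) (at r within {0..<R})"
  unfolding Q'_def[abs_def] by (rule DERIV_integral_from_1[OF continuous_\<kappa>])

lemma continuous_Q': "continuous_on {0..<R} (Q' \<kappa>)"
  by (rule DERIV_continuous_on[OF DERIV_Q'])

text \<open>Writing \<open>Q(u) = u Q'(u) - \<integral> \<tau> \<kappa>(\<tau>) d\<tau>\<close> separates the two occurrences of \<open>u\<close>; in the
derivative, the terms \<open>u \<kappa>(u)\<close> cancel.\<close>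

lemma DERIV_Q:
  assumes "r \<in> {0..<R}"
  shows "(Q \<kappa> has_real_derivative Q' \<kappa> r) (at r within {0..<R})"
proof -
  let ?A = "\<lambda>u. LBINT \<tau>=1..ereal u. \<tau> * \<kappa> \<tau>"
  have cont: "continuous_on {0..<R} (\<lambda>\<tau>. \<tau> * \<kappa> \<tau>)" by (intro continuous_intros continuous_\<kappa>)
  have D: "((\<lambda>u. u * Q' \<kappa> u - ?A u) has_real_derivative Q' \<kappa> r) (at r within {0..<R})"
    by (auto intro!: derivative_eq_intros DERIV_Q'[OF assms] DERIV_integral_from_1[OF cont assms])
  have eq: "Q \<kappa> u = u * Q' \<kappa> u - ?A u" if u: "u \<in> {0..<R}" for u
  proof -
    have sub: "{min 1 u..max 1 u} \<subseteq> {0..<R}" using u R by auto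
    \<comment> \<open>The orientation of the integral from \<open>1\<close> to \<open>u\<close> depends on which endpoint is larger.\<close>
    have int: "interval_lebesgue_integrable lborel 1 (ereal u) f" if f: "continuous_on {0..<R} f" for f
    proof -
      have "set_integrable lborel {min 1 u..max 1 u} f"
        by (intro borel_integrable_atLeastAtMost' continuous_on_subset[OF f sub])
      then have "set_integrable lborel {min 1 u<..<max 1 u} f"
        by (rule set_integrable_subset) auto
      then show ?thesis
        by (cases "1 \<le> u") (simp_all add: interval_lebesgue_integrable_def one_ereal_def min_def max_def)
    qed
    have i1: "interval_lebesgue_integrable lborel 1 (ereal u) (\<lambda>\<tau>. u * \<kappa> \<tau>)"
      and i2: "interval_lebesgue_integrable lborel 1 (ereal u) (\<lambda>\<tau>. \<tau> * \<kappa> \<tau>)"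
      by (intro int continuous_intros continuous_\<kappa>)+
    have "Q \<kappa> u = (LBINT \<tau>=1..ereal u. u * \<kappa> \<tau> - \<tau> * \<kappa> \<tau>)"
      by (simp add: Q_def left_diff_distrib)
    also have "\<dots> = u * Q' \<kappa> u - ?A u"
      using interval_lebesgue_integral_diff(2)[OF i1 i2] by (simp add: Q'_def)
    finally show ?thesis .
  qed
  show ?thesis
    by (rule has_field_derivative_transform_within[OF D zero_less_one assms]) (rule eq[symmetric])
qed

lemma continuous_Q: "continuous_on {0..<R} (Q \<kappa>)"
  by (rule DERIV_continuous_on[OF DERIV_Q])

end

section \<open>Densities of the required regularity\<close>

text \<open>The two regularity clauses come with unrelated partial derivatives. For \<open>t > 0\<close> uniqueness of
derivatives identifies the first-order ones, so that the second-order one differentiates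
\<open>\<rho>x\<close>.\<close>

lemma solution_regularity_partials:
  assumes "solution_regularity R \<rho>"
  obtains \<rho>t \<rho>x \<rho>xx where
    "continuous_on half_plane (\<lambda>(t, x). \<rho> t x)"
    "continuous_on half_plane (\<lambda>(t, x). \<rho>t t x)"
    "continuous_on half_plane (\<lambda>(t, x). \<rho>x t x)"
    "continuous_on open_half_plane (\<lambda>(t, x). \<rho>xx t x)"
    "\<And>t x. t \<ge> 0 \<Longrightarrow> (\<rho> t has_real_derivative \<rho>x t x) (at x)"
    "\<And>t x. t > 0 \<Longrightarrow> ((\<lambda>s. \<rho> s x) has_real_derivative \<rho>t t x) (at t)"
    "\<And>t x. t > 0 \<Longrightarrow> (\<rho>x t has_real_derivative \<rho>xx t x) (at x)"
proof -
  have C1: "Ck_on 1 half_plane (\<lambda>(t, x). \<rho> t x)" and C2: "Ck_on 2 open_half_plane (\<lambda>(t, x). \<rho> t x)"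
    using assms by (auto simp: solution_regularity_def)
  obtain f1 f2 where D: "\<And>p. p \<in> half_plane \<Longrightarrow>
      ((\<lambda>(t, x). \<rho> t x) has_derivative (\<lambda>v. f1 p * fst v + f2 p * snd v)) (at p within half_plane)"
    and cont: "continuous_on half_plane f1" "continuous_on half_plane f2"
    using C1 unfolding One_nat_def Ck_on.simps by blast
  obtain g1 g2 where E: "\<And>p. p \<in> open_half_plane \<Longrightarrow>
      ((\<lambda>(t, x). \<rho> t x) has_derivative (\<lambda>v. g1 p * fst v + g2 p * snd v)) (at p within open_half_plane)"
    and C: "Ck_on (Suc 0) open_half_plane g2"
    using C2 unfolding numeral_2_eq_2 Ck_on.simps(2)[of "Suc 0"] by blast
  obtain k1 k2 where K: "\<And>p. p \<in> open_half_plane \<Longrightarrow>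
      (g2 has_derivative (\<lambda>v. k1 p * fst v + k2 p * snd v)) (at p within open_half_plane)"
    and contk: "continuous_on open_half_plane k2"
    using C unfolding Ck_on.simps by blast
  have cont\<rho>: "continuous_on half_plane (\<lambda>(t, x). \<rho> t x)"
    using D by (auto simp: continuous_on_eq_continuous_within intro: has_derivative_continuous)
  have Dx: "(\<rho> t has_real_derivative f2 (t, x)) (at x)" if "t \<ge> 0" for t x
    using partial_derivatives(1)[OF D[of "(t, x)"]] that by auto
  have Dt: "((\<lambda>s. \<rho> s x) has_real_derivative f1 (t, x)) (at t)" if "t > 0" for t x
  proof -
    have "((\<lambda>s. \<rho> s x) has_real_derivative f1 (t, x)) (at t within {0<..})"
      by (rule DERIV_subset[OF partial_derivatives(2)[OF D[of "(t, x)"]]]) (use that in auto)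
    then show ?thesis using that by (simp add: at_within_open[OF _ open_greaterThan])
  qed
  have g2: "g2 (t, x) = f2 (t, x)" if "t > 0" for t x
    using DERIV_unique[OF partial_derivatives(1)[OF E[of "(t, x)"]] Dx[of t x]] that by auto
  have Dxx: "((\<lambda>y. f2 (t, y)) has_real_derivative k2 (t, x)) (at x)" if "t > 0" for t x
  proof -
    have "((\<lambda>(t, x). g2 (t, x)) has_derivative (\<lambda>v. k1 (t, x) * fst v + k2 (t, x) * snd v)) (at (t, x) within open_half_plane)"
      using K[of "(t, x)"] that by simp
    from partial_derivatives(1)[OF this] have "((\<lambda>y. g2 (t, y)) has_real_derivative k2 (t, x)) (at x)"
      using that by simp
    then show ?thesis using g2[OF that] by simp
  qed
  show thesis
    by (rule that[of "\<lambda>t x. f1 (t, x)" "\<lambda>t x. f2 (t, x)" "\<lambda>t x. k2 (t, x)"])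
      (use cont\<rho> cont contk Dx Dt Dxx in simp_all)
qed

locale regular_density = diffusion_data +
  fixes \<rho> \<rho>t \<rho>x \<rho>xx :: "real \<Rightarrow> real \<Rightarrow> real"
  assumes \<rho>_range: "\<And>t x. t \<ge> 0 \<Longrightarrow> \<rho> t x \<in> {0..<R}"
    and continuous_\<rho>: "continuous_on half_plane (\<lambda>(t, x). \<rho> t x)"
    and continuous_\<rho>t: "continuous_on half_plane (\<lambda>(t, x). \<rho>t t x)"
    and continuous_\<rho>x: "continuous_on half_plane (\<lambda>(t, x). \<rho>x t x)"
    and continuous_\<rho>xx: "continuous_on open_half_plane (\<lambda>(t, x). \<rho>xx t x)"
    and DERIV_\<rho>_x: "\<And>t x. t \<ge> 0 \<Longrightarrow> (\<rho> t has_real_derivative \<rho>x t x) (at x)"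
    and DERIV_\<rho>_t: "\<And>t x. t > 0 \<Longrightarrow> ((\<lambda>s. \<rho> s x) has_real_derivative \<rho>t t x) (at t)"
    and DERIV_\<rho>x_x: "\<And>t x. t > 0 \<Longrightarrow> (\<rho>x t has_real_derivative \<rho>xx t x) (at x)"
begin

text \<open>Continuous up to \<open>t = 0\<close>, whereas the \<open>x\<close>-derivative \<open>slope_x\<close> contains \<open>\<rho>xx\<close> and is available
for \<open>t > 0\<close> only.\<close>

definition slope :: "real \<Rightarrow> real \<Rightarrow> real" where
  "slope t x = \<kappa> (\<rho> t x) * \<rho>x t x"

definition slope_x :: "real \<Rightarrow> real \<Rightarrow> real" where
  "slope_x t x = \<kappa>' (\<rho> t x) * \<rho>x t x * \<rho>x t x + \<rho>xx t x * \<kappa> (\<rho> t x)"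

text \<open>The velocity, expressed by the partial derivative \<open>\<rho>x\<close> instead of \<open>deriv\<close>, so that the
continuity rules on the half-plane apply to it.\<close>

definition speed :: "real \<Rightarrow> real \<Rightarrow> real" where
  "speed t x = h (- slope t x)"

definition flux_x :: "real \<Rightarrow> real \<Rightarrow> real" where
  "flux_x t x = \<rho>x t x * speed t x + deriv h (- slope t x) * - slope_x t x * \<rho> t x"

lemma continuous_comp_\<rho>:
  "continuous_on {0..<R} f \<Longrightarrow> continuous_on half_plane (\<lambda>(t, x). f (\<rho> t x))"
  by (rule continuous_on_pair_compose[OF _ continuous_\<rho>]) (use \<rho>_range in auto)

lemma continuous_slope: "continuous_on half_plane (\<lambda>(t, x). slope t x)"
  unfolding slope_def by (intro continuous_on_pair continuous_comp_\<rho> continuous_\<kappa> continuous_\<rho>x)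

lemma continuous_speed: "continuous_on half_plane (\<lambda>(t, x). speed t x)"
  unfolding speed_def
  by (rule continuous_on_pair_compose[OF continuous_h[of UNIV]]) (auto intro: continuous_on_pair continuous_slope)

lemma open_half_plane_continuous:
  "continuous_on half_plane f \<Longrightarrow> continuous_on open_half_plane f"
  by (rule continuous_on_subset) auto

lemma continuous_flux_x: "continuous_on open_half_plane (\<lambda>(t, x). flux_x t x)"
proof -
  have "continuous_on half_plane (\<lambda>(t, x). deriv h (- slope t x))"
    by (rule continuous_on_pair_compose[OF continuous_deriv_h]) (auto intro: continuous_on_pair continuous_slope)
  then show ?thesis
    unfolding flux_x_def slope_x_def
    by (intro continuous_on_pair continuous_\<rho>xx open_half_plane_continuous continuous_comp_\<rho>
        continuous_\<kappa> continuous_\<kappa>' continuous_\<rho>x continuous_speed continuous_\<rho>)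
qed

lemma DERIV_comp_\<rho>_x:
  assumes "\<And>r. r \<in> {0..<R} \<Longrightarrow> (f has_real_derivative f' r) (at r within {0..<R})" "t \<ge> 0"
  shows "((\<lambda>y. f (\<rho> t y)) has_real_derivative f' (\<rho> t x) * \<rho>x t x) (at x)"
  by (rule DERIV_chain_within[OF assms(1) DERIV_\<rho>_x, where N = UNIV]) (use \<rho>_range assms(2) in auto)

lemma DERIV_comp_\<rho>_t:
  assumes "\<And>r. r \<in> {0..<R} \<Longrightarrow> (f has_real_derivative f' r) (at r within {0..<R})" "t > 0"
  shows "((\<lambda>s. f (\<rho> s x)) has_real_derivative f' (\<rho> t x) * \<rho>t t x) (at t)"
  by (rule DERIV_chain_within[OF assms(1) DERIV_\<rho>_t, where N = "{0<..}"]) (use \<rho>_range assms(2) in auto)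

lemma DERIV_slope: "t > 0 \<Longrightarrow> (slope t has_real_derivative slope_x t x) (at x)"
  unfolding slope_def[abs_def] slope_x_def
  by (rule DERIV_mult[OF DERIV_comp_\<rho>_x[OF DERIV_\<kappa>] DERIV_\<rho>x_x]) auto

lemma DERIV_speed:
  "t > 0 \<Longrightarrow> (speed t has_real_derivative deriv h (- slope t x) * - slope_x t x) (at x)"
  unfolding speed_def[abs_def] by (rule DERIV_chain2[OF DERIV_h DERIV_minus[OF DERIV_slope]])

lemma DERIV_flux:
  "t > 0 \<Longrightarrow> ((\<lambda>y. \<rho> t y * speed t y) has_real_derivative flux_x t x) (at x)"
  unfolding flux_x_def by (rule DERIV_mult[OF DERIV_\<rho>_x DERIV_speed]) auto

lemma deriv_\<rho>_x: "t \<ge> 0 \<Longrightarrow> deriv (\<rho> t) x = \<rho>x t x"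
  by (rule DERIV_imp_deriv[OF DERIV_\<rho>_x])

lemma velocity_eq_speed: "t \<ge> 0 \<Longrightarrow> velocity \<kappa> h \<rho> t = speed t"
  by (auto simp: velocity_def speed_def slope_def deriv_\<rho>_x)

lemma pde_iff:
  "t > 0 \<Longrightarrow> deriv (\<lambda>s. \<rho> s x) t + deriv (\<lambda>y. \<rho> t y * velocity \<kappa> h \<rho> t y) x = \<rho>t t x + flux_x t x"
  by (simp add: velocity_eq_speed DERIV_imp_deriv[OF DERIV_\<rho>_t] DERIV_imp_deriv[OF DERIV_flux])

lemma slope_eq_0: "t \<ge> 0 \<Longrightarrow> \<rho> t x \<le> 1 \<Longrightarrow> slope t x = 0"
  using \<kappa>_zero \<rho>_range[of t x] by (simp add: slope_def)

lemma speed_eq_0: "t \<ge> 0 \<Longrightarrow> \<rho> t x \<le> 1 \<Longrightarrow> speed t x = 0"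
  by (simp add: speed_def slope_eq_0 h_0)

lemma speed_bound: "\<bar>speed t x\<bar> \<le> max 1 b"
  using h_bounds[of "- slope t x"] unfolding speed_def by linarith

lemma inv_h_speed: "inv h (speed t x) = - slope t x"
  by (simp add: speed_def inv_h)

lemma continuous_profile: "t \<ge> 0 \<Longrightarrow> continuous_on A (\<rho> t)"
  by (rule continuous_on_slices(1)[OF continuous_\<rho>]) simp

text \<open>The integrand is the \<open>x\<close>-derivative of \<open>\<phi> Q'(\<rho>)\<close>, which vanishes outside a bounded interval.\<close>

lemma integral_flux_law:
  assumes "test_function \<phi>" "t \<ge> 0"
  shows "integrable lebesgue (\<lambda>x. \<phi> t x * slope t x + deriv (\<phi> t) x * Q' \<kappa> (\<rho> t x))"
    and "(LINT x|lebesgue. \<phi> t x * slope t x + deriv (\<phi> t) x * Q' \<kappa> (\<rho> t x)) = 0"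
proof -
  obtain \<phi>t \<phi>x L where L: "L > 0"
    and cont: "continuous_on half_plane (\<lambda>(t, x). \<phi> t x)" "continuous_on half_plane (\<lambda>(t, x). \<phi>t t x)"
      "continuous_on half_plane (\<lambda>(t, x). \<phi>x t x)"
    and D: "\<And>t x. t \<ge> 0 \<Longrightarrow> (\<phi> t has_real_derivative \<phi>x t x) (at x)"
      "\<And>t x. t > 0 \<Longrightarrow> ((\<lambda>s. \<phi> s x) has_real_derivative \<phi>t t x) (at t)"
    and z: "\<And>t x. t \<ge> 0 \<Longrightarrow> t \<ge> L \<or> \<bar>x\<bar> \<ge> L \<Longrightarrow> \<phi> t x = 0"
      "\<And>t x. t \<ge> 0 \<Longrightarrow> t \<ge> L \<or> \<bar>x\<bar> \<ge> L \<Longrightarrow> \<phi>x t x = 0"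
      "\<And>t x. t > 0 \<Longrightarrow> t \<ge> L \<or> \<bar>x\<bar> \<ge> L \<Longrightarrow> \<phi>t t x = 0"
    by (rule test_functionE[OF assms(1)]) (rule that; assumption)
  let ?f = "\<lambda>x. \<phi> t x * slope t x + deriv (\<phi> t) x * Q' \<kappa> (\<rho> t x)"
  have f: "?f x = \<kappa> (\<rho> t x) * \<rho>x t x * \<phi> t x + \<phi>x t x * Q' \<kappa> (\<rho> t x)" for x
    using assms(2) by (simp add: slope_def DERIV_imp_deriv[OF D(1)] mult_ac)
  have c: "continuous_on {-L..L} ?f"
    unfolding f using assms(2)
    by (intro continuous_intros continuous_on_slices(1)[OF continuous_\<rho>x] continuous_on_slices(1)[OF cont(1)] 
      continuous_on_slices(1)[OF cont(3)] continuous_on_slices(1)[OF continuous_comp_\<rho>[OF continuous_\<kappa>]] 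
      continuous_on_slices(1)[OF continuous_comp_\<rho>[OF continuous_Q']]) auto
  have s: "?f x = 0" if "x \<notin> {-L..L}" for x
  proof -
    have "\<bar>x\<bar> \<ge> L" using that by (auto simp: abs_if)
    then show ?thesis using z[of t x] assms(2) by (simp add: DERIV_imp_deriv[OF D(1)])
  qed
  show "integrable lebesgue ?f" by (rule lebesgue_integral_supported(1)[OF c s])
  have "(?f has_integral Q' \<kappa> (\<rho> t L) * \<phi> t L - Q' \<kappa> (\<rho> t (-L)) * \<phi> t (-L)) {-L..L}"
  proof (rule fundamental_theorem_of_calculus)
    fix x
    have "((\<lambda>y. Q' \<kappa> (\<rho> t y) * \<phi> t y) has_real_derivative ?f x) (at x)"
      unfolding f using assms(2) by (intro DERIV_mult DERIV_comp_\<rho>_x[OF DERIV_Q'] D(1))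
    then show "((\<lambda>y. Q' \<kappa> (\<rho> t y) * \<phi> t y) has_vector_derivative ?f x) (at x within {-L..L})"
      by (simp add: has_real_derivative_iff_has_vector_derivative has_vector_derivative_at_within)
  qed (use L in simp)
  then have "integral {-L..L} ?f = 0"
    using z(1)[of t L] z(1)[of t "-L"] assms(2) L by (simp add: integral_unique)
  then show "(LINT x|lebesgue. ?f x) = 0"
    using lebesgue_integral_supported(2)[OF c s] by simp
qed

lemma continuous_cond_B_function: "continuous_on half_plane (\<lambda>(t, x). \<kappa> (\<rho> t x) * deriv (\<rho> t) x)"
  by (rule continuous_on_eq[OF continuous_slope]) (auto simp: slope_def deriv_\<rho>_x)

lemma half_plane_sets: "half_plane \<in> sets lebesgue"
  by (rule borel_closed[THEN sets_completionI_sets[of _ lborel, simplified]]) (auto intro: closed_Times)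

text \<open>The product is continuous on the closed half-plane, which lies in the closure of the open one;
an almost everywhere bound is therefore a bound everywhere, including \<open>t = 0\<close>.\<close>

lemma cond_B_iff: "cond_B \<kappa> \<rho> \<longleftrightarrow> (\<exists>C. \<forall>t\<ge>0. \<forall>x. \<bar>slope t x\<bar> \<le> C)"
proof
  assume "cond_B \<kappa> \<rho>"
  then obtain C where "AE p in lebesgue_on half_plane. \<bar>case p of (t, x) \<Rightarrow> \<kappa> (\<rho> t x) * deriv (\<rho> t) x\<bar> \<le> C"
    unfolding cond_B_def Linf_def by blast
  then have "AE p in lebesgue. p \<in> half_plane \<longrightarrow> \<bar>case p of (t, x) \<Rightarrow> \<kappa> (\<rho> t x) * deriv (\<rho> t) x\<bar> \<le> C"
    using half_plane_sets by (simp add: AE_restrict_space_iff)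
  then have ae: "AE p in lebesgue. p \<in> open_half_plane \<longrightarrow> (case p of (t, x) \<Rightarrow> slope t x) \<in> {-C..C}"
    by (rule eventually_mono) (auto simp: slope_def deriv_\<rho>_x abs_le_iff)
  have "open open_half_plane" by (intro open_Times) auto
  note * = AE_in_closed_imp_all[OF this open_half_plane_continuous[OF continuous_slope] closed_atLeastAtMost ae]
  have pos: "slope t x \<in> {-C..C}" if "t > 0" for t x
    using *[of "(t, x)"] that by simp
  have cont: "continuous_on {0..} (\<lambda>t. slope t x)" for x by (rule continuous_on_slices(2)[OF continuous_slope])
  have "\<bar>slope t x\<bar> \<le> C" if "t \<ge> 0" for t x
    by (rule nonneg_time_le_of_pos_time_le[where f = "\<lambda>t. \<bar>slope t x\<bar>", OF continuous_on_rabs[OF cont] _ that])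
      (use pos in \<open>auto simp: abs_le_iff minus_le_iff\<close>)
  then show "\<exists>C. \<forall>t\<ge>0. \<forall>x. \<bar>slope t x\<bar> \<le> C" by blast
next
  assume "\<exists>C. \<forall>t\<ge>0. \<forall>x. \<bar>slope t x\<bar> \<le> C"
  then obtain C where C: "\<And>t x. t \<ge> 0 \<Longrightarrow> \<bar>slope t x\<bar> \<le> C" by blast
  have "AE p in lebesgue_on half_plane. \<bar>case p of (t, x) \<Rightarrow> \<kappa> (\<rho> t x) * deriv (\<rho> t) x\<bar> \<le> C"
    by (rule AE_I2) (use C in \<open>auto simp: slope_def deriv_\<rho>_x\<close>)
  then show "cond_B \<kappa> \<rho>"
    unfolding cond_B_def Linf_def
    using continuous_imp_measurable_on_sets_lebesgue[OF continuous_cond_B_function half_plane_sets] by blast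
qed

lemma cond_A_iff:
  "cond_A R \<rho> \<longleftrightarrow> (\<forall>t\<ge>0. (INF x. \<rho> t x) = 0) \<and> (\<exists>m<R. \<forall>t\<ge>0. \<forall>x. \<rho> t x \<le> m)"
proof -
  have bdd: "bdd_above ((\<lambda>(t, x). \<rho> t x) ` half_plane)"
    by (rule bdd_aboveI[of _ R]) (use \<rho>_range in \<open>auto intro: less_imp_le\<close>)
  have "(SUP (t, x)\<in>half_plane. \<rho> t x) < R \<longleftrightarrow> (\<exists>m<R. \<forall>t\<ge>0. \<forall>x. \<rho> t x \<le> m)"
  proof
    assume *: "(SUP (t, x)\<in>half_plane. \<rho> t x) < R"
    have "\<rho> t x \<le> (SUP (t, x)\<in>half_plane. \<rho> t x)" if "t \<ge> 0" for t x
      using cSUP_upper[OF _ bdd, of "(t, x)"] that by simp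
    then show "\<exists>m<R. \<forall>t\<ge>0. \<forall>x. \<rho> t x \<le> m" using * by blast
  next
    assume "\<exists>m<R. \<forall>t\<ge>0. \<forall>x. \<rho> t x \<le> m"
    then obtain m where m: "m < R" "\<And>t x. t \<ge> 0 \<Longrightarrow> \<rho> t x \<le> m" by blast
    have "(SUP (t, x)\<in>half_plane. \<rho> t x) \<le> m" by (rule cSUP_least) (use m in auto)
    then show "(SUP (t, x)\<in>half_plane. \<rho> t x) < R" using m by simp
  qed
  then show ?thesis unfolding cond_A_def by blast
qed

lemma INF_eq_0_of_ess_inf:
  assumes "t \<ge> 0" "ess_inf (\<rho> t) = 0"
  shows "(INF x. \<rho> t x) = 0"
proof (rule ccontr)
  assume ne: "(INF x. \<rho> t x) \<noteq> 0"
  have "(INF x. \<rho> t x) \<ge> 0" by (rule cINF_greatest) (use \<rho>_range assms in auto)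
  with ne have pos: "(INF x. \<rho> t x) > 0" by simp
  have "bdd_below (range (\<rho> t))" by (rule bdd_belowI[of _ 0]) (use \<rho>_range assms in auto)
  then have le: "(INF x. \<rho> t x) \<le> \<rho> t x" for x by (rule cINF_lower) simp
  have "ereal (INF x. \<rho> t x) \<le> ess_inf (\<rho> t)"
    by (intro ess_inf_ge_iff[THEN iffD2] AE_I2 continuous_measurable_lebesgue continuous_profile assms) (use le in simp)
  then have "ereal (INF x. \<rho> t x) \<le> 0" unfolding assms(2) .
  with pos show False by simp
qed

end

section \<open>Classical solutions are weak solutions\<close>

text \<open>The pointwise content of a classical solution satisfying the conditions (A), (B) and (C); \<open>m\<close> and
\<open>C\<close> are bounds obtained from (A) and (B). By continuity the decay at infinity holds in the
ordinary sense at \<open>t = 0\<close> as well.\<close>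

locale classical_density = regular_density +
  fixes m C :: real
  assumes pde: "\<And>t x. t > 0 \<Longrightarrow> \<rho>t t x + flux_x t x = 0"
    and lim: "\<And>t. t \<ge> 0 \<Longrightarrow> (\<rho> t \<longlongrightarrow> 0) at_top" "\<And>t. t \<ge> 0 \<Longrightarrow> (\<rho> t \<longlongrightarrow> 0) at_bot"
    and m: "m < R" "\<And>t x. t \<ge> 0 \<Longrightarrow> \<rho> t x \<le> m"
    and slope_bound: "\<And>t x. t \<ge> 0 \<Longrightarrow> \<bar>slope t x\<bar> \<le> C"
    and integrable_\<rho>: "\<And>t. t \<ge> 0 \<Longrightarrow> integrable lebesgue (\<rho> t)"
begin

text \<open>Decay of the density switches the velocity off near infinity because \<open>\<kappa>\<close> vanishes on \<open>[0,1]\<close>.\<close>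

lemma eventually_speed_0:
  assumes "t \<ge> 0" "(\<rho> t \<longlongrightarrow> 0) F"
  shows "\<forall>\<^sub>F x in F. speed t x = 0"
  using order_tendstoD(2)[OF assms(2) zero_less_one]
  by (rule eventually_mono) (simp add: speed_eq_0[OF assms(1)])

lemma flux_tendsto_0:
  assumes "t \<ge> 0" "(\<rho> t \<longlongrightarrow> 0) F"
  shows "((\<lambda>x. \<rho> t x * speed t x) \<longlongrightarrow> 0) F"
  by (rule tendsto_eventually, rule eventually_mono[OF eventually_speed_0[OF assms]]) simp

lemma flux_bound: "t \<ge> 0 \<Longrightarrow> \<bar>\<rho> t x * speed t x\<bar> \<le> R * max 1 b"
  unfolding abs_mult using \<rho>_range[of t x] by (intro mult_mono speed_bound) auto

lemma continuous_flux: "continuous_on half_plane (\<lambda>(t, x). \<rho> t x * speed t x)"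
  by (intro continuous_on_pair continuous_\<rho> continuous_speed)

text \<open>The dissipative balance law with zero source, applied to \<open>\<rho>\<close> and to \<open>-\<rho>\<close>.\<close>

lemma mass_conservation:
  assumes "T \<ge> 0"
  shows "(LINT x|lebesgue. \<rho> T x) = (LINT x|lebesgue. \<rho> 0 x)"
proof (rule antisym)
  show "(LINT x|lebesgue. \<rho> T x) \<le> (LINT x|lebesgue. \<rho> 0 x)"
    by (rule integral_mono_of_dissipative_balance_law[where V = "\<lambda>t x. \<rho> t x * speed t x"
          and u = \<rho>t and v = flux_x and S = "\<lambda>_ _. 0" and K = "R * max 1 b"])
      (assumption | rule assms continuous_\<rho> open_half_plane_continuous[OF continuous_\<rho>t] continuous_flux
        continuous_on_pair_const DERIV_\<rho>_t DERIV_flux pde integrable_\<rho> flux_bound flux_tendsto_0 lim order_refl)+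
  have "(LINT x|lebesgue. - \<rho> T x) \<le> (LINT x|lebesgue. - \<rho> 0 x)"
  proof (rule integral_mono_of_dissipative_balance_law[where V = "\<lambda>t x. - (\<rho> t x * speed t x)"
        and u = "\<lambda>t x. - \<rho>t t x" and v = "\<lambda>t x. - flux_x t x" and S = "\<lambda>_ _. 0" and K = "R * max 1 b"])
    show "- \<rho>t t x + - flux_x t x = 0" if "t > 0" for t x using pde[OF that, of x] by simp
    show "((\<lambda>x. - (\<rho> t x * speed t x)) \<longlongrightarrow> 0) at_top" "((\<lambda>x. - (\<rho> t x * speed t x)) \<longlongrightarrow> 0) at_bot" if "t \<ge> 0" for t
      using tendsto_minus[OF flux_tendsto_0] lim that by fastforce+
    show "\<bar>- (\<rho> t x * speed t x)\<bar> \<le> R * max 1 b" if "t \<ge> 0" for t x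
      using flux_bound[OF that] by simp
  qed (assumption | rule assms continuous_on_pair_minus continuous_\<rho> open_half_plane_continuous[OF continuous_\<rho>t]
        continuous_flux continuous_on_pair_const DERIV_minus DERIV_\<rho>_t DERIV_flux integrable_minus integrable_\<rho> order_refl)+
  then show "(LINT x|lebesgue. \<rho> 0 x) \<le> (LINT x|lebesgue. \<rho> T x)" by simp
qed

lemma integrable_Q_\<rho>:
  assumes "t \<ge> 0"
  shows "integrable lebesgue (\<lambda>x. Q \<kappa> (\<rho> t x))"
proof -
  obtain N where N: "N > 0" "\<And>x. \<bar>x\<bar> \<ge> N \<Longrightarrow> \<rho> t x \<le> 1"
    using eventually_small_outside_interval[OF lim(1)[OF assms] lim(2)[OF assms] zero_less_one] by blast
  show ?thesis
  proof (rule lebesgue_integral_supported(1))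
    show "continuous_on {-N..N} (\<lambda>x. Q \<kappa> (\<rho> t x))"
      using continuous_on_slices(1)[OF continuous_comp_\<rho>[OF continuous_Q]] assms by simp
    show "Q \<kappa> (\<rho> t x) = 0" if "x \<notin> {-N..N}" for x
    proof -
      have "\<rho> t x \<le> 1" using that by (intro N(2)) (auto simp: abs_if)
      then show ?thesis using \<rho>_range[OF assms, of x] by (intro Q_eq_0) auto
    qed
  qed
qed

text \<open>Multiplying the differential equation by \<open>Q'(\<rho>)\<close> gives a balance law for \<open>Q(\<rho>)\<close> with flux
\<open>Q'(\<rho>)\<rho>w\<close> and source \<open>\<kappa>(\<rho>)\<rho>_x \<rho> w\<close>, and \<open>y h(-y) \<le> 0\<close> makes the source
nonpositive.\<close>

lemma energy_dissipation:
  assumes "T \<ge> 0"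
  shows "(LINT x|lebesgue. Q \<kappa> (\<rho> T x)) \<le> (LINT x|lebesgue. Q \<kappa> (\<rho> 0 x))"
proof -
  have "compact (Q' \<kappa> ` {0..m})"
    by (intro compact_continuous_image continuous_on_subset[OF continuous_Q']) (use m in auto)
  then obtain K where K: "\<And>r. r \<in> {0..m} \<Longrightarrow> \<bar>Q' \<kappa> r\<bar> \<le> K"
    using compact_imp_bounded[of "Q' \<kappa> ` {0..m}"] unfolding bounded_iff real_norm_def by blast
  show ?thesis
  proof (rule integral_mono_of_dissipative_balance_law[where U = "\<lambda>t x. Q \<kappa> (\<rho> t x)" 
        and V = "\<lambda>t x. Q' \<kappa> (\<rho> t x) * (\<rho> t x * speed t x)"
        and u = "\<lambda>t x. Q' \<kappa> (\<rho> t x) * \<rho>t t x"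
        and v = "\<lambda>t x. \<kappa> (\<rho> t x) * \<rho>x t x * (\<rho> t x * speed t x) + flux_x t x * Q' \<kappa> (\<rho> t x)"
        and S = "\<lambda>t x. slope t x * (\<rho> t x * speed t x)" and K = "K * (R * max 1 b)"])
    show "Q' \<kappa> (\<rho> t x) * \<rho>t t x + (\<kappa> (\<rho> t x) * \<rho>x t x * (\<rho> t x * speed t x) + flux_x t x * Q' \<kappa> (\<rho> t x))
        = slope t x * (\<rho> t x * speed t x)" if "t > 0" for t x
    proof -
      have "\<rho>t t x = - flux_x t x" using pde[OF that, of x] by simp
      then show ?thesis by (simp add: slope_def)
    qed
    show "slope t x * (\<rho> t x * speed t x) \<le> 0" if "t \<ge> 0" for t x
    proof -
      have "\<rho> t x * (slope t x * speed t x) \<le> 0"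
        using \<rho>_range[OF that, of x] dissipation_sign[of "slope t x"]
        by (intro mult_nonneg_nonpos[of "\<rho> t x"]) (auto simp: speed_def)
      then show ?thesis by (simp add: mult_ac)
    qed
    show "\<bar>Q' \<kappa> (\<rho> t x) * (\<rho> t x * speed t x)\<bar> \<le> K * (R * max 1 b)" if "t \<ge> 0" for t x
    proof -
      have "\<bar>Q' \<kappa> (\<rho> t x)\<bar> \<le> K" using \<rho>_range[OF that, of x] m(2)[OF that, of x] by (intro K) auto
      then show ?thesis
        unfolding abs_mult[of "Q' \<kappa> (\<rho> t x)"] by (intro mult_mono flux_bound that) auto
    qed
    have "((\<lambda>x. Q' \<kappa> (\<rho> t x) * (\<rho> t x * speed t x)) \<longlongrightarrow> 0) F" if "t \<ge> 0" "(\<rho> t \<longlongrightarrow> 0) F" for t F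
      by (rule tendsto_eventually, rule eventually_mono[OF eventually_speed_0[OF that]]) simp
    then show "((\<lambda>x. Q' \<kappa> (\<rho> t x) * (\<rho> t x * speed t x)) \<longlongrightarrow> 0) at_top"
      "((\<lambda>x. Q' \<kappa> (\<rho> t x) * (\<rho> t x * speed t x)) \<longlongrightarrow> 0) at_bot" if "t \<ge> 0" for t
      using that lim by auto
    show "((\<lambda>y. Q' \<kappa> (\<rho> t y) * (\<rho> t y * speed t y)) has_real_derivative
        \<kappa> (\<rho> t x) * \<rho>x t x * (\<rho> t x * speed t x) + flux_x t x * Q' \<kappa> (\<rho> t x)) (at x)" if "t > 0" for t x
      using that by (intro DERIV_mult DERIV_comp_\<rho>_x[OF DERIV_Q'] DERIV_flux) auto
    show "continuous_on open_half_plane (\<lambda>(t, x). Q' \<kappa> (\<rho> t x) * \<rho>t t x)"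
      by (intro open_half_plane_continuous continuous_on_pair continuous_comp_\<rho> continuous_Q' continuous_\<rho>t)
    show "continuous_on half_plane (\<lambda>(t, x). slope t x * (\<rho> t x * speed t x))"
      "continuous_on half_plane (\<lambda>(t, x). Q' \<kappa> (\<rho> t x) * (\<rho> t x * speed t x))"
      by (intro continuous_on_pair continuous_slope continuous_flux continuous_comp_\<rho> continuous_Q')+
  qed (assumption | rule assms continuous_comp_\<rho> continuous_Q DERIV_comp_\<rho>_t DERIV_Q integrable_Q_\<rho> order_refl)+
qed

text \<open>The balance law for \<open>\<rho>\<phi>\<close> with flux \<open>\<rho>w\<phi>\<close> on a rectangle containing the support of \<open>\<phi>\<close>: of
the boundary terms, only the one at \<open>t = 0\<close> survives.\<close>

lemma weak_continuity_equation:
  assumes "test_function \<phi>"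
  defines "I \<equiv> \<lambda>t. LINT x|lebesgue. \<rho> t x * (speed t x * deriv (\<phi> t) x + deriv (\<lambda>s. \<phi> s x) t)"
  shows "set_integrable lebesgue {0..} I"
    and "- (LINT x|lebesgue. \<phi> 0 x * \<rho> 0 x) = (LINT t:{0..}|lebesgue. I t)"
proof -
  obtain \<phi>t \<phi>x L where L: "L > 0"
    and cont: "continuous_on half_plane (\<lambda>(t, x). \<phi> t x)" "continuous_on half_plane (\<lambda>(t, x). \<phi>t t x)"
      "continuous_on half_plane (\<lambda>(t, x). \<phi>x t x)"
    and D: "\<And>t x. t \<ge> 0 \<Longrightarrow> (\<phi> t has_real_derivative \<phi>x t x) (at x)"
      "\<And>t x. t > 0 \<Longrightarrow> ((\<lambda>s. \<phi> s x) has_real_derivative \<phi>t t x) (at t)"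
    and z: "\<And>t x. t \<ge> 0 \<Longrightarrow> t \<ge> L \<or> \<bar>x\<bar> \<ge> L \<Longrightarrow> \<phi> t x = 0"
      "\<And>t x. t \<ge> 0 \<Longrightarrow> t \<ge> L \<or> \<bar>x\<bar> \<ge> L \<Longrightarrow> \<phi>x t x = 0"
      "\<And>t x. t > 0 \<Longrightarrow> t \<ge> L \<or> \<bar>x\<bar> \<ge> L \<Longrightarrow> \<phi>t t x = 0"
    by (rule test_functionE[OF assms(1)]) (rule that; assumption)
  define S where "S = (\<lambda>t x. \<rho> t x * (speed t x * \<phi>x t x + \<phi>t t x))"
  have contS: "continuous_on half_plane (\<lambda>(t, x). S t x)"
    unfolding S_def by (intro continuous_on_pair continuous_\<rho> continuous_speed cont)
  have I: "I t = integral {-L..L} (S t)" if "t > 0" for t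
  proof -
    have "I t = (LINT x|lebesgue. S t x)"
      using that by (simp add: I_def S_def DERIV_imp_deriv[OF D(1)] DERIV_imp_deriv[OF D(2)])
    also have "\<dots> = integral {-L..L} (S t)"
    proof (rule lebesgue_integral_supported(2))
      show "continuous_on {-L..L} (S t)" using that by (intro continuous_on_slices(1)[OF contS]) auto
      show "S t x = 0" if "x \<notin> {-L..L}" for x
      proof -
        have "\<bar>x\<bar> \<ge> L" using that by (auto simp: abs_if)
        then show ?thesis using z(2,3)[of t x] \<open>t > 0\<close> by (simp add: S_def)
      qed
    qed
    finally show ?thesis .
  qed
  have F: "continuous_on {0..} (\<lambda>t. integral {-L..L} (S t))"
    by (rule continuous_on_partial_integral[OF contS])
  have F0: "integral {-L..L} (S t) = 0" if "t > L" for t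
  proof -
    have "S t = (\<lambda>x. 0)" using z(2,3)[of t] that L by (auto simp: S_def)
    then show ?thesis by simp
  qed
  show "set_integrable lebesgue {0..} I"
    by (rule time_integral_supported(1)[OF F AE_I2[OF impI[OF I]] F0 L])
  have "integral {-L..L} (\<lambda>x. \<rho> L x * \<phi> L x) - integral {-L..L} (\<lambda>x. \<rho> 0 x * \<phi> 0 x)
      + integral {0..L} (\<lambda>t. \<rho> t L * speed t L * \<phi> t L - \<rho> t (-L) * speed t (-L) * \<phi> t (-L))
      = integral {0..L} (\<lambda>t. integral {-L..L} (S t))"
  proof (rule balance_law[where u = "\<lambda>t x. \<rho>t t x * \<phi> t x + \<phi>t t x * \<rho> t x"
        and v = "\<lambda>t x. flux_x t x * \<phi> t x + \<phi>x t x * (\<rho> t x * speed t x)"])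
    show "\<rho>t t x * \<phi> t x + \<phi>t t x * \<rho> t x + (flux_x t x * \<phi> t x + \<phi>x t x * (\<rho> t x * speed t x)) = S t x"
      if "t > 0" for t x
    proof -
      have "\<rho>t t x = - flux_x t x" using pde[OF that, of x] by simp
      then show ?thesis by (simp add: S_def algebra_simps)
    qed
    show "((\<lambda>y. \<rho> t y * speed t y * \<phi> t y) has_real_derivative flux_x t x * \<phi> t x + \<phi>x t x * (\<rho> t x * speed t x)) (at x)"
      if "t > 0" for t x using that by (intro DERIV_mult DERIV_flux D) auto
    show "((\<lambda>s. \<rho> s x * \<phi> s x) has_real_derivative \<rho>t t x * \<phi> t x + \<phi>t t x * \<rho> t x) (at t)"
      if "t > 0" for t x using that by (intro DERIV_mult DERIV_\<rho>_t D)
  qed (use L in \<open>auto intro!: continuous_on_pair continuous_\<rho> continuous_speed cont contS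
        open_half_plane_continuous[OF continuous_\<rho>t] open_half_plane_continuous[OF continuous_\<rho>]
        open_half_plane_continuous[OF cont(1)] open_half_plane_continuous[OF cont(2)]\<close>)
  moreover have "integral {0..L} (\<lambda>t. \<rho> t L * speed t L * \<phi> t L - \<rho> t (-L) * speed t (-L) * \<phi> t (-L)) = 0"
    using integral_cong[of "{0..L}" "\<lambda>t. \<rho> t L * speed t L * \<phi> t L - \<rho> t (-L) * speed t (-L) * \<phi> t (-L)" "\<lambda>_. 0"] z(1) L by simp
  moreover have "(\<lambda>x. \<rho> L x * \<phi> L x) = (\<lambda>x. 0)" using z(1)[of L] L by auto
  moreover have "(LINT x|lebesgue. \<phi> 0 x * \<rho> 0 x) = integral {-L..L} (\<lambda>x. \<phi> 0 x * \<rho> 0 x)"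
  proof (rule lebesgue_integral_supported(2))
    show "continuous_on {-L..L} (\<lambda>x. \<phi> 0 x * \<rho> 0 x)"
      by (intro continuous_intros continuous_on_slices(1)[OF continuous_\<rho>] continuous_on_slices(1)[OF cont(1)]) auto
    show "\<phi> 0 x * \<rho> 0 x = 0" if "x \<notin> {-L..L}" for x
    proof -
      have "\<bar>x\<bar> \<ge> L" using that by (auto simp: abs_if)
      then show ?thesis using z(1)[of 0 x] by simp
    qed
  qed
  moreover have "(LINT t:{0..}|lebesgue. I t) = integral {0..L} (\<lambda>t. integral {-L..L} (S t))"
    by (rule time_integral_supported(2)[OF F AE_I2[OF impI[OF I]] F0 L])
  ultimately show "- (LINT x|lebesgue. \<phi> 0 x * \<rho> 0 x) = (LINT t:{0..}|lebesgue. I t)"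
    by (simp add: mult.commute)
qed

lemma speed_lower_bound: "t \<ge> 0 \<Longrightarrow> h (- C) \<le> speed t x"
  and speed_upper_bound: "t \<ge> 0 \<Longrightarrow> speed t x \<le> h C"
  using slope_bound[of t x] unfolding speed_def
  by (auto simp: strict_mono_less_eq[OF strict_mono_h] abs_le_iff)

lemma speed_L1_Linf:
  assumes "t \<ge> 0"
  shows "L1_Linf (speed t)"
proof -
  obtain N where N: "N > 0" "\<And>x. \<bar>x\<bar> \<ge> N \<Longrightarrow> \<rho> t x \<le> 1"
    using eventually_small_outside_interval[OF lim(1)[OF assms] lim(2)[OF assms] zero_less_one] by blast
  have "integrable lebesgue (speed t)"
  proof (rule lebesgue_integral_supported(1))
    show "continuous_on {-N..N} (speed t)"
      using assms by (intro continuous_on_slices(1)[OF continuous_speed]) simp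
    show "speed t x = 0" if "x \<notin> {-N..N}" for x
    proof -
      have "\<rho> t x \<le> 1" using that by (intro N(2)) (auto simp: abs_if)
      then show ?thesis using speed_eq_0[OF assms] by simp
    qed
  qed
  then show ?thesis
    unfolding Linf_def using speed_bound by (auto intro!: AE_I2)
qed

end

lemma (in classical_density) classical_imp_weak:
  assumes init: "AE x in lebesgue. \<rho> 0 x = \<rho>0 x"
    and X: "\<And>t. t \<ge> 0 \<Longrightarrow> Linf lebesgue (\<rho> t)" "\<And>t. t \<ge> 0 \<Longrightarrow> ess_inf (\<rho> t) = 0"
  shows "weak_solution R b \<kappa> h \<rho>0 \<rho> (velocity \<kappa> h \<rho>)"
proof -
  have sup_\<rho>: "(SUP t\<in>{0..}. ess_sup (\<rho> t)) < ereal R"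
  proof -
    have "(SUP t\<in>{0..}. ess_sup (\<rho> t)) \<le> ereal m"
      using m(2) integrable_\<rho> by (intro SUP_least ess_sup_le_iff[THEN iffD2] AE_I2) auto
    then show ?thesis using m(1) by (simp add: le_less_trans)
  qed
  have meas: "speed t \<in> borel_measurable lebesgue" if "t \<ge> 0" for t
    using speed_L1_Linf[OF that] by auto
  have inf_w: "-1 < (INF t\<in>{0..}. ess_inf (speed t))"
  proof -
    have "ereal (h (- C)) \<le> (INF t\<in>{0..}. ess_inf (speed t))"
      using speed_lower_bound meas by (intro INF_greatest ess_inf_ge_iff[THEN iffD2] AE_I2) auto
    moreover have "-1 < ereal (h (- C))"
      using h_bounds(1)[of "- C"] by (simp add: one_ereal_def)
    ultimately show ?thesis by (rule less_le_trans[rotated])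
  qed
  have sup_w: "(SUP t\<in>{0..}. ess_sup (speed t)) < ereal b"
  proof -
    have "(SUP t\<in>{0..}. ess_sup (speed t)) \<le> ereal (h C)"
      using speed_upper_bound meas by (intro SUP_least ess_sup_le_iff[THEN iffD2] AE_I2) auto
    then show ?thesis using h_bounds(2)[of C] by (simp add: le_less_trans)
  qed
  have inf_sup: "(INF t\<in>{0..}. ess_inf (speed t)) \<le> (SUP t\<in>{0..}. ess_sup (speed t))"
  proof -
    have "(INF t\<in>{0..}. ess_inf (speed t)) \<le> ess_inf (speed 0)" by (rule INF_lower) simp
    also have "\<dots> \<le> ess_sup (speed 0)" by (rule ess_inf_le_ess_sup[OF meas]) simp
    also have "\<dots> \<le> (SUP t\<in>{0..}. ess_sup (speed t))" by (rule SUP_upper) simp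
    finally show ?thesis .
  qed
  have init_f: "(LINT x|lebesgue. f (\<rho>0 x)) = (LINT x|lebesgue. f (\<rho> 0 x))" for f :: "real \<Rightarrow> real"
    by (rule lebesgue_integral_cong_AE) (use init in \<open>auto elim: eventually_mono\<close>)
  have init_\<phi>: "(LINT x|lebesgue. \<phi> 0 x * \<rho>0 x) = (LINT x|lebesgue. \<phi> 0 x * \<rho> 0 x)" for \<phi> :: "real \<Rightarrow> real \<Rightarrow> real"
    by (rule lebesgue_integral_cong_AE) (use init in \<open>auto elim: eventually_mono\<close>)
  have mass: "(LINT x|lebesgue. \<rho> t x) = (LINT x|lebesgue. \<rho>0 x)" if "t \<ge> 0" for t
    unfolding mass_conservation[OF that] by (rule lebesgue_integral_cong_AE[OF init])
  have energy: "(LINT x|lebesgue. Q \<kappa> (\<rho> t x)) \<le> (LINT x|lebesgue. Q \<kappa> (\<rho>0 x))" if "t \<ge> 0" for t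
    unfolding init_f by (rule energy_dissipation[OF that])
  have weak: "let I = (\<lambda>t. LINT x|lebesgue. \<rho> t x * (velocity \<kappa> h \<rho> t x * deriv (\<phi> t) x + deriv (\<lambda>s. \<phi> s x) t));
             J = (\<lambda>t. LINT x|lebesgue. \<phi> t x * inv h (velocity \<kappa> h \<rho> t x) - deriv (\<phi> t) x * Q' \<kappa> (\<rho> t x))
         in set_integrable lebesgue {0..} I \<and>
            - (LINT x|lebesgue. \<phi> 0 x * \<rho>0 x) = (LINT t:{0..}|lebesgue. I t) \<and>
            set_integrable lebesgue {0..} J \<and> (LINT t:{0..}|lebesgue. J t) = 0"
    if \<phi>: "test_function \<phi>" for \<phi>
  proof -
    let ?I = "\<lambda>t. LINT x|lebesgue. \<rho> t x * (speed t x * deriv (\<phi> t) x + deriv (\<lambda>s. \<phi> s x) t)"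
    let ?I' = "\<lambda>t. LINT x|lebesgue. \<rho> t x * (velocity \<kappa> h \<rho> t x * deriv (\<phi> t) x + deriv (\<lambda>s. \<phi> s x) t)"
    let ?J = "\<lambda>t. LINT x|lebesgue. \<phi> t x * inv h (velocity \<kappa> h \<rho> t x) - deriv (\<phi> t) x * Q' \<kappa> (\<rho> t x)"
    have "(\<lambda>t. indicator {0..} t *\<^sub>R ?I' t) = (\<lambda>t. indicator {0..} t *\<^sub>R ?I t)"
      by (auto simp: indicator_def velocity_eq_speed)
    then have I: "set_integrable lebesgue {0..} ?I'" "(LINT t:{0..}|lebesgue. ?I' t) = (LINT t:{0..}|lebesgue. ?I t)"
      using weak_continuity_equation(1)[OF \<phi>] unfolding set_integrable_def set_lebesgue_integral_def by simp_all
    have J0: "?J t = 0" if "t \<ge> 0" for t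
    proof -
      have "?J t = (LINT x|lebesgue. - (\<phi> t x * slope t x + deriv (\<phi> t) x * Q' \<kappa> (\<rho> t x)))"
        using that by (simp add: velocity_eq_speed inv_h_speed)
      also have "\<dots> = - (LINT x|lebesgue. \<phi> t x * slope t x + deriv (\<phi> t) x * Q' \<kappa> (\<rho> t x))"
        by (rule integral_minus)
      finally show ?thesis using integral_flux_law(2)[OF \<phi> that] by simp
    qed
    then have "(\<lambda>t. indicator {0..} t *\<^sub>R ?J t) = (\<lambda>t. 0)"
      by (auto simp: indicator_def)
    then have "set_integrable lebesgue {0..} ?J" "(LINT t:{0..}|lebesgue. ?J t) = 0"
      unfolding set_integrable_def set_lebesgue_integral_def by simp_all
    then show ?thesis
      using I weak_continuity_equation(2)[OF \<phi>] init_\<phi> by (simp add: Let_def)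
  qed
  have L1: "\<forall>t\<ge>0. L1_Linf (\<rho> t) \<and> L1_Linf (velocity \<kappa> h \<rho> t)"
    using integrable_\<rho> X(1) speed_L1_Linf by (simp add: velocity_eq_speed)
  have tends: "\<forall>t>0. ess_tendsto (\<rho> t) 0 at_top \<and> ess_tendsto (\<rho> t) 0 at_bot"
    using lim unfolding ess_tendsto_def by (metis (mono_tags, lifting) AE_I2 less_imp_le)
  have eq: "(INF t\<in>{0..}. ess_inf (velocity \<kappa> h \<rho> t)) = (INF t\<in>{0..}. ess_inf (speed t))"
    "(SUP t\<in>{0..}. ess_sup (velocity \<kappa> h \<rho> t)) = (SUP t\<in>{0..}. ess_sup (speed t))"
    by (auto simp: velocity_eq_speed)
  show ?thesis
    unfolding weak_solution_def eq
    using L1 X(2) sup_\<rho> inf_w inf_sup sup_w mass energy tends weak by blast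
qed

lemma (in regular_density) classical_imp_weak_solution:
  assumes sol: "classical_solution R \<kappa> h \<rho>0 \<rho>" and A: "cond_A R \<rho>" and B: "cond_B \<kappa> \<rho>" and C: "cond_C R \<rho>"
  shows "weak_solution R b \<kappa> h \<rho>0 \<rho> (velocity \<kappa> h \<rho>)"
proof -
  obtain m where m: "m < R" "\<And>t x. t \<ge> 0 \<Longrightarrow> \<rho> t x \<le> m"
    using A unfolding cond_A_iff by blast
  obtain K where K: "\<And>t x. t \<ge> 0 \<Longrightarrow> \<bar>slope t x\<bar> \<le> K"
    using B unfolding cond_B_iff by blast
  have X: "L1_Linf (\<rho> t)" "ess_inf (\<rho> t) = 0" "ess_tendsto (\<rho> t) 0 at_top" "ess_tendsto (\<rho> t) 0 at_bot" if "t \<ge> 0" for t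
    using C that unfolding cond_C_def X_space_def by blast+
  interpret classical_density R b \<kappa> h \<kappa>' \<rho> \<rho>t \<rho>x \<rho>xx m K
  proof
    show "\<rho>t t x + flux_x t x = 0" if "t > 0" for t x
      using sol that unfolding classical_solution_def by (simp add: pde_iff)
    show "(\<rho> t \<longlongrightarrow> 0) at_top" "(\<rho> t \<longlongrightarrow> 0) at_bot" if "t \<ge> 0" for t
      using ess_tendsto_continuous_at_infinity[OF continuous_profile[OF that]] X[OF that] by blast+
  qed (use m K X in blast)+
  show ?thesis
    by (rule classical_imp_weak) (use sol X in \<open>auto simp: classical_solution_def\<close>)
qed

section \<open>Weak solutions are classical solutions\<close>

locale weak_density = regular_density +
  fixes \<rho>0 :: "real \<Rightarrow> real" and w :: "real \<Rightarrow> real \<Rightarrow> real"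
  assumes weak: "weak_solution R b \<kappa> h \<rho>0 \<rho> w"
    and integrable_\<rho>0: "integrable lebesgue \<rho>0"
begin

lemma w_measurable: "t \<ge> 0 \<Longrightarrow> w t \<in> borel_measurable lebesgue"
  using weak unfolding weak_solution_def by (auto intro: borel_measurable_integrable)

lemma w_bounds:
  obtains m M where "-1 < m" "m < b" "-1 < M" "M < b" "\<And>t. t \<ge> 0 \<Longrightarrow> AE x in lebesgue. m \<le> w t x \<and> w t x \<le> M"
proof -
  have "ereal (-1) < (INF t\<in>{0..}. ess_inf (w t))" and sup: "(SUP t\<in>{0..}. ess_sup (w t)) < ereal b"
    using weak unfolding weak_solution_def by (auto simp: one_ereal_def)
  then obtain m where m: "ereal (-1) < ereal m" "ereal m < (INF t\<in>{0..}. ess_inf (w t))"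
    using ereal_dense2 by blast
  obtain M where M: "(SUP t\<in>{0..}. ess_sup (w t)) < ereal M" "ereal M < ereal b"
    using ereal_dense2[OF sup] by blast
  show thesis
  \<comment> \<open>Including \<open>0\<close> in the range makes both endpoints lie in \<open>(-1,b)\<close>.\<close>
  proof (rule that[of "min m 0" "max M 0"])
    show "AE x in lebesgue. min m 0 \<le> w t x \<and> w t x \<le> max M 0" if t: "t \<ge> 0" for t
    proof -
      have "ereal m \<le> ess_inf (w t)"
        by (rule less_imp_le[OF less_le_trans[OF m(2) INF_lower]]) (use t in simp)
      then have "AE x in lebesgue. ereal m \<le> ereal (w t x)"
        using ess_inf_ge_iff[OF w_measurable[OF t]] by blast
      moreover have "ess_sup (w t) \<le> ereal M"
        by (intro less_imp_le[OF le_less_trans[OF SUP_upper M(1)]]) (use t in simp)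
      then have "AE x in lebesgue. ereal (w t x) \<le> ereal M"
        using ess_sup_le_iff[OF w_measurable[OF t]] by blast
      ultimately show ?thesis by eventually_elim auto
    qed
  qed (use m(1) M(2) b in auto)
qed

lemma \<rho>_bound: obtains m where "m < R" "\<And>t x. t \<ge> 0 \<Longrightarrow> \<rho> t x \<le> m"
proof -
  have "(SUP t\<in>{0..}. ess_sup (\<rho> t)) < ereal R"
    using weak unfolding weak_solution_def by blast
  then obtain m where m: "(SUP t\<in>{0..}. ess_sup (\<rho> t)) < ereal m" "ereal m < ereal R"
    using ereal_dense2 by blast
  show thesis
  proof (rule that[of m])
    show "\<rho> t x \<le> m" if t: "t \<ge> 0" for t x
    proof (rule continuous_le_ess_sup[OF continuous_profile[OF t]])
      show "ess_sup (\<rho> t) \<le> ereal m"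
        by (rule less_imp_le[OF le_less_trans[OF SUP_upper m(1)]]) (use t in simp)
    qed
  qed (use m(2) in simp)
qed

text \<open>The inverse of \<open>h\<close> has unspecified values outside \<open>(-1,b)\<close>, so \<open>\<beta>(w)\<close> is replaced by the
inverse at \<open>w\<close> clipped to a compact subinterval of \<open>(-1,b)\<close> that contains its essential range: a
monotone, hence Borel, function of \<open>w\<close>.\<close>

lemma inv_h_w:
  assumes "t \<ge> 0"
  obtains f K where "f \<in> borel_measurable lebesgue" "\<And>x. \<bar>f x\<bar> \<le> K" "AE x in lebesgue. inv h (w t x) = f x"
proof -
  obtain m M where mM: "-1 < m" "m < b" "-1 < M" "M < b" and ae: "AE x in lebesgue. m \<le> w t x \<and> w t x \<le> M"
    using w_bounds assms by metis
  define clip where "clip y = max m (min M y)" for y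
  define f where "f x = inv h (clip (w t x))" for x
  have mono: "inv h y \<le> inv h z" if "y \<le> z" "y \<in> {-1<..<b}" "z \<in> {-1<..<b}" for y z
    using that h_inv strict_mono_less_eq[OF strict_mono_h, of "inv h y" "inv h z"] by simp
  have clip: "clip y \<in> {-1<..<b}" for y
    using mM by (auto simp: clip_def)
  have "mono (\<lambda>y. inv h (clip y))"
    by (intro monoI mono clip) (auto simp: clip_def)
  then have "(\<lambda>y. inv h (clip y)) \<in> borel_measurable borel" by (rule borel_measurable_mono)
  then have meas: "f \<in> borel_measurable lebesgue"
    unfolding f_def by (rule measurable_compose[OF w_measurable[OF assms]])
  show thesis
  proof (rule that[OF meas])
    fix x
    have "inv h m \<le> f x" "f x \<le> inv h (max m M)"
      using mM unfolding f_def by (intro mono clip; auto simp: clip_def)+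
    then show "\<bar>f x\<bar> \<le> max \<bar>inv h m\<bar> \<bar>inv h (max m M)\<bar>" by linarith
    show "AE x in lebesgue. inv h (w t x) = f x"
      using ae by eventually_elim (simp add: f_def clip_def)
  qed
qed

lemma integrable_bumps_inv_h_w:
  assumes "t \<ge> 0" "c \<in> bumps S"
  shows "integrable lebesgue (\<lambda>x. c x * inv h (w t x))"
proof -
  obtain f K where f: "f \<in> borel_measurable lebesgue" "\<And>x. \<bar>f x\<bar> \<le> K" "AE x in lebesgue. inv h (w t x) = f x"
    using inv_h_w[OF assms(1)] by metis
  have ae: "AE x in lebesgue. c x * inv h (w t x) = c x * f x"
    using f(3) by eventually_elim simp
  show ?thesis
    unfolding lebesgue_integrable_cong_AE[OF ae] by (rule integrable_bumps_mult_bounded[OF assms(2) f(1,2)])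
qed

text \<open>Fix a spatial bump \<open>c\<close>. Testing the second identity with \<open>a(t)c(x)\<close> and integrating by parts in
\<open>x\<close> shows that \<open>\<integral>c (\<beta>(w) + \<kappa>(\<rho>)\<rho>_x) dx\<close> integrates to zero against every temporal bump
\<open>a\<close>, so it vanishes for almost all \<open>t\<close>. As there are countably many \<open>c\<close>, almost every \<open>t\<close> works
for all of them, and the fundamental lemma applies in \<open>x\<close>.\<close>

lemma velocity_law:
  "AE t in lebesgue. t > 0 \<longrightarrow> (AE x in lebesgue. w t x = speed t x)"
proof -
  obtain m M where mM: "-1 < m" "m < b" "-1 < M" "M < b"
    and bd: "\<And>t. t \<ge> 0 \<Longrightarrow> AE x in lebesgue. m \<le> w t x \<and> w t x \<le> M"
    by (rule w_bounds) (rule that; assumption)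
  define G where "G c t = (LINT x|lebesgue. c x * (inv h (w t x) + slope t x))" for c t
  have int1: "integrable lebesgue (\<lambda>x. c x * slope t x)" if "t \<ge> 0" "c \<in> bumps UNIV" for c t
    using that by (intro integrable_bumps_continuous continuous_on_slices(1)[OF continuous_slope]) auto
  have int: "integrable lebesgue (\<lambda>x. c x * (inv h (w t x) + slope t x))" if "t \<ge> 0" "c \<in> bumps UNIV" for c t
    using integrable_bumps_inv_h_w[OF that] int1[OF that] by (simp add: distrib_left)
  have "AE t in lebesgue. t \<in> {0<..} \<longrightarrow> G c t = 0" if c: "c \<in> bumps UNIV" for c
  proof (rule AE_zero_if_bump_integrals_zero[OF open_greaterThan])
    fix a assume a: "a \<in> bumps {0<..}"
    let ?\<phi> = "\<lambda>t x. a t * c x"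
    let ?J = "\<lambda>t. LINT x|lebesgue. ?\<phi> t x * inv h (w t x) - deriv (?\<phi> t) x * Q' \<kappa> (\<rho> t x)"
    have \<phi>: "test_function ?\<phi>" by (rule product_test_function[OF a c])
    have J: "?J t = a t * G c t" if t: "t \<ge> 0" for t
    proof -
      have "?J t = (LINT x|lebesgue. (a t * (c x * (inv h (w t x) + slope t x))) -
          (?\<phi> t x * slope t x + deriv (?\<phi> t) x * Q' \<kappa> (\<rho> t x)))"
        by (rule Bochner_Integration.integral_cong) (auto simp: algebra_simps)
      also have "\<dots> = (LINT x|lebesgue. (a t * (c x * (inv h (w t x) + slope t x)))) - 
          (LINT x|lebesgue. ?\<phi> t x * slope t x + deriv (?\<phi> t) x * Q' \<kappa> (\<rho> t x))"
        by (intro Bochner_Integration.integral_diff integrable_mult_right int[OF t c] integral_flux_law(1)[OF \<phi> t])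
      also have "\<dots> = a t * G c t"
        unfolding integral_flux_law(2)[OF \<phi> t] by (simp add: G_def)
      finally show ?thesis .
    qed
    have "a t = 0" if "t \<le> 0" for t
      by (rule bumps_support[OF a]) (use that in \<open>auto simp: subset_iff\<close>)
    then have eq: "(\<lambda>t. indicator {0..} t *\<^sub>R ?J t) = (\<lambda>t. a t * G c t)"
      using J by (auto simp: indicator_def fun_eq_iff)
    have "set_integrable lebesgue {0..} ?J" "(LINT t:{0..}|lebesgue. ?J t) = 0"
      using weak \<phi> unfolding weak_solution_def Let_def by blast+
    then show "integrable lebesgue (\<lambda>t. a t * G c t)" "(LINT t|lebesgue. a t * G c t) = 0"
      unfolding set_integrable_def set_lebesgue_integral_def eq by simp_all
  qed
  then have "AE t in lebesgue. \<forall>c\<in>bumps UNIV. t \<in> {0<..} \<longrightarrow> G c t = 0"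
    by (intro iffD2[OF AE_ball_countable[OF countable_bumps]] ballI)
  then show ?thesis
  proof (rule eventually_mono)
    fix t assume *: "\<forall>c\<in>bumps UNIV. t \<in> {0<..} \<longrightarrow> G c t = 0"
    show "t > 0 \<longrightarrow> (AE x in lebesgue. w t x = speed t x)"
    proof
      assume t: "t > 0"
      have "AE x in lebesgue. x \<in> UNIV \<longrightarrow> inv h (w t x) + slope t x = 0"
        by (rule AE_zero_if_bump_integrals_zero[OF open_UNIV]) (use int * t in \<open>auto simp: G_def\<close>)
      with bd[OF less_imp_le[OF t]] show "AE x in lebesgue. w t x = speed t x"
      proof eventually_elim
        case (elim x)
        then have "w t x \<in> {-1<..<b}" using mM by auto
        then have "w t x = h (inv h (w t x))" by (simp add: h_inv)
        also have "inv h (w t x) = - slope t x" using elim by auto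
        finally show ?case by (simp add: speed_def)
      qed
    qed
  qed
qed

text \<open>The velocity law puts the continuous function \<open>h(-\<kappa>(\<rho>)\<rho>_x)\<close> into a compact subinterval of
\<open>(-1,b)\<close>, first for almost all \<open>t\<close>, then for all \<open>t > 0\<close> and finally at \<open>t = 0\<close>; the inverse of
\<open>h\<close> is bounded there.\<close>

lemma slope_bounded: obtains C where "\<And>t x. t \<ge> 0 \<Longrightarrow> \<bar>slope t x\<bar> \<le> C"
proof -
  obtain m M where mM: "-1 < m" "m < b" "-1 < M" "M < b"
    and bd: "\<And>t. t \<ge> 0 \<Longrightarrow> AE x in lebesgue. m \<le> w t x \<and> w t x \<le> M"
    by (rule w_bounds) (rule that; assumption)
  have ae: "AE t in lebesgue. t \<in> {0<..} \<longrightarrow> speed t x \<in> {m..M}" for x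
    using velocity_law
  proof (rule eventually_mono)
    fix t assume *: "t > 0 \<longrightarrow> (AE x in lebesgue. w t x = speed t x)"
    show "t \<in> {0<..} \<longrightarrow> speed t x \<in> {m..M}"
    proof
      assume "t \<in> {0<..}"
      then have t: "t \<ge> 0" "AE x in lebesgue. w t x = speed t x" using * by auto
      show "speed t x \<in> {m..M}"
      proof (rule AE_in_closed_imp_all[where f = "speed t" and x = x, OF open_UNIV _ closed_atLeastAtMost])
        show "continuous_on UNIV (speed t)" using t by (intro continuous_on_slices(1)[OF continuous_speed]) simp
        show "AE x in lebesgue. x \<in> UNIV \<longrightarrow> speed t x \<in> {m..M}"
          using t(2) bd[OF t(1)] by eventually_elim auto
      qed simp
    qed
  qed
  have cont: "continuous_on {0..} (\<lambda>t. speed t x)" for x by (rule continuous_on_slices(2)[OF continuous_speed])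
  have pos: "speed t x \<in> {m..M}" if "t > 0" for t x
    by (rule AE_in_closed_imp_all[where f = "\<lambda>t. speed t x" and x = t,
          OF open_greaterThan continuous_on_subset[OF cont] closed_atLeastAtMost ae]) (use that in auto)
  have sp: "m \<le> speed t x" "speed t x \<le> M" if "t \<ge> 0" for t x
  proof -
    show "speed t x \<le> M"
      by (rule nonneg_time_le_of_pos_time_le[where f = "\<lambda>t. speed t x", OF cont _ that]) (use pos in auto)
    have "- speed t x \<le> - m"
      by (rule nonneg_time_le_of_pos_time_le[where f = "\<lambda>t. - speed t x", OF continuous_on_minus[OF cont] _ that])
        (use pos in auto)
    then show "m \<le> speed t x" by simp
  qed
  have bound: "\<bar>slope t x\<bar> \<le> \<bar>inv h m\<bar> + \<bar>inv h M\<bar>" if "t \<ge> 0" for t x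
  proof -
    have "h (inv h m) = m" "h (inv h M) = M" using mM by (intro h_inv; simp)+
    with sp[OF that, of x] have "h (inv h m) \<le> h (- slope t x)" "h (- slope t x) \<le> h (inv h M)"
      by (simp_all add: speed_def)
    then have "inv h m \<le> - slope t x" "- slope t x \<le> inv h M"
      by (simp_all only: strict_mono_less_eq[OF strict_mono_h])
    then show ?thesis by linarith
  qed
  show thesis by (rule that[OF bound])
qed

lemma \<rho>_tendsto_0:
  assumes "t > 0"
  shows "(\<rho> t \<longlongrightarrow> 0) at_top" "(\<rho> t \<longlongrightarrow> 0) at_bot"
  using weak assms ess_tendsto_continuous_at_infinity[OF continuous_profile[of t UNIV]]
  unfolding weak_solution_def by auto

text \<open>By the velocity law, \<open>w\<close> may be replaced by \<open>h(-\<kappa>(\<rho>)\<rho>_x)\<close> in the first identity for the test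
function \<open>a(t)c(x)\<close>. Since \<open>\<rho>\<close> is continuously differentiable up to \<open>t = 0\<close>, the terms that
contain \<open>a'\<close> can be removed with the balance law for \<open>\<rho>(t,x)a(t)c(x)\<close> with zero flux. The
outcome is free of \<open>a'\<close>, and \<open>a(0)\<close> enters through the two initial data.\<close>

lemma tested_continuity_equation:
  assumes a: "C2 a" "\<And>t. t \<notin> {p<..<q} \<Longrightarrow> a t = 0" and c: "C2 c" "\<And>x. x \<notin> {p'<..<q'} \<Longrightarrow> c x = 0"
    and c': "\<And>x. (c has_real_derivative c' x) (at x)" "continuous_on UNIV c'"
    and "0 < q" "p' < q'"
  defines "P \<equiv> \<lambda>t. integral {p'..q'} (\<lambda>x. c' x * (\<rho> t x * speed t x) - c x * \<rho>t t x)"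
  shows "integral {0..q} (\<lambda>t. a t * P t) = a 0 * ((LINT x|lebesgue. c x * \<rho> 0 x) - (LINT x|lebesgue. c x * \<rho>0 x))"
proof -
  obtain a' where a': "\<And>t. (a has_real_derivative a' t) (at t)" "continuous_on UNIV a" "continuous_on UNIV a'"
    using C2E[OF a(1)] by metis
  have contc: "continuous_on UNIV c" by (rule DERIV_everywhere_continuous[OF c'(1)])
  have c'0: "c' x = 0" if "x \<notin> {p'..q'}" for x
  proof -
    have "((\<lambda>_. 0) has_real_derivative c' x) (at x)"
      by (rule has_field_derivative_transform_within_open[OF c'(1), of "- {p'..q'}"]) (use that c(2) in auto)
    then show ?thesis using DERIV_unique[OF _ DERIV_const[of 0]] by blast
  qed
  have a'0: "a' t = 0" if "t \<notin> {p..q}" for t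
  proof -
    have "((\<lambda>_. 0) has_real_derivative a' t) (at t)"
      by (rule has_field_derivative_transform_within_open[OF a'(1), of "- {p..q}"]) (use that a(2) in auto)
    then show ?thesis using DERIV_unique[OF _ DERIV_const[of 0]] by blast
  qed
  have pair: "continuous_on A (\<lambda>(t, x). f t)" "continuous_on A (\<lambda>(t, x). f x)"
    if "continuous_on UNIV f" for f :: "real \<Rightarrow> real" and A :: "(real \<times> real) set"
    unfolding case_prod_unfold by (auto intro!: continuous_on_compose2[OF that] continuous_intros)
  let ?\<phi> = "\<lambda>t x. a t * c x"
  define F where "F = (\<lambda>t x. \<rho> t x * (speed t x * (a t * c' x) + a' t * c x))"
  define E where "E = (\<lambda>t x. \<rho>t t x * (a t * c x) + a' t * c x * \<rho> t x)"
  have contF: "continuous_on half_plane (\<lambda>(t, x). F t x)" and contE: "continuous_on half_plane (\<lambda>(t, x). E t x)"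
    unfolding F_def E_def
    by (intro continuous_on_pair continuous_\<rho> continuous_speed continuous_\<rho>t pair a' c' contc)+
  have \<phi>: "test_function ?\<phi>"
    by (rule test_function_product[OF a(1) c(1), of p q p' q']) (use a(2) c(2) in auto)
  define I where "I = (\<lambda>t. LINT x|lebesgue. \<rho> t x * (w t x * deriv (?\<phi> t) x + deriv (\<lambda>s. ?\<phi> s x) t))"
  have D: "deriv (?\<phi> t) x = a t * c' x" "deriv (\<lambda>s. ?\<phi> s x) t = a' t * c x" for t x
    by (auto intro!: DERIV_imp_deriv DERIV_cmult c'(1) DERIV_cmult_right a'(1))
  have I: "AE t in lebesgue. t > 0 \<longrightarrow> I t = integral {p'..q'} (F t)"
    using velocity_law
  proof (rule eventually_mono)
    fix t assume *: "t > 0 \<longrightarrow> (AE x in lebesgue. w t x = speed t x)"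
    show "t > 0 \<longrightarrow> I t = integral {p'..q'} (F t)"
    proof
      assume t: "t > 0"
      have "I t = (LINT x|lebesgue. F t x)"
        unfolding I_def
      proof (rule lebesgue_integral_cong_AE)
        have "AE x in lebesgue. w t x = speed t x" using * t by blast
        then show "AE x in lebesgue. \<rho> t x * (w t x * deriv (?\<phi> t) x + deriv (\<lambda>s. ?\<phi> s x) t) = F t x"
          by (rule eventually_mono) (simp add: F_def D)
      qed
      also have "\<dots> = integral {p'..q'} (F t)"
      proof (rule lebesgue_integral_supported(2))
        show "continuous_on {p'..q'} (F t)" using t by (intro continuous_on_slices(1)[OF contF]) simp
        show "F t x = 0" if "x \<notin> {p'..q'}" for x using that c'0[of x] c(2)[of x] by (auto simp: F_def)
      qed
      finally show "I t = integral {p'..q'} (F t)" .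
    qed
  qed
  have F0: "integral {p'..q'} (F t) = 0" if "t > q" for t
  proof -
    have "F t = (\<lambda>x. 0)" using that a(2)[of t] a'0[of t] by (auto simp: F_def)
    then show ?thesis by simp
  qed
  have "(LINT t:{0..}|lebesgue. I t) = integral {0..q} (\<lambda>t. integral {p'..q'} (F t))"
    by (rule time_integral_supported(2)[OF continuous_on_partial_integral[OF contF] I F0 \<open>0 < q\<close>])
  moreover have "- (LINT x|lebesgue. ?\<phi> 0 x * \<rho>0 x) = (LINT t:{0..}|lebesgue. I t)"
    using weak \<phi> unfolding weak_solution_def Let_def I_def by blast
  ultimately have 1: "integral {0..q} (\<lambda>t. integral {p'..q'} (F t)) = - (a 0 * (LINT x|lebesgue. c x * \<rho>0 x))"
    by (simp add: mult.assoc)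
  have "integral {p'..q'} (\<lambda>x. \<rho> q x * ?\<phi> q x) - integral {p'..q'} (\<lambda>x. \<rho> 0 x * ?\<phi> 0 x)
      + integral {0..q} (\<lambda>t. 0 - 0) = integral {0..q} (\<lambda>t. integral {p'..q'} (E t))"
  proof (rule balance_law[where u = E and v = "\<lambda>_ _. 0"])
    show "((\<lambda>s. \<rho> s x * (a s * c x)) has_real_derivative E t x) (at t)" if "t > 0" for t x
      unfolding E_def using that by (intro DERIV_mult DERIV_\<rho>_t DERIV_cmult_right a'(1))
    show "continuous_on half_plane (\<lambda>(t, x). \<rho> t x * (a t * c x))"
      by (intro continuous_on_pair continuous_\<rho> pair a' contc)
  qed (use \<open>0 < q\<close> \<open>p' < q'\<close> in \<open>auto intro: contE open_half_plane_continuous[OF contE] continuous_on_pair_const\<close>)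
  moreover have "(LINT x|lebesgue. c x * \<rho> 0 x) = integral {p'..q'} (\<lambda>x. c x * \<rho> 0 x)"
    by (rule lebesgue_integral_supported(2))
      (use c(2) in \<open>auto intro!: continuous_intros continuous_on_subset[OF contc] continuous_profile\<close>)
  moreover have "(\<lambda>x. \<rho> 0 x * ?\<phi> 0 x) = (\<lambda>x. a 0 * (c x * \<rho> 0 x))" by auto
  moreover have "a q = 0" using a(2)[of q] by simp
  ultimately have 2: "integral {0..q} (\<lambda>t. integral {p'..q'} (E t)) = - (a 0 * (LINT x|lebesgue. c x * \<rho> 0 x))"
    by simp
  have P: "a t * P t = integral {p'..q'} (F t) - integral {p'..q'} (E t)" if "t \<ge> 0" for t
  proof -
    have "integral {p'..q'} (F t) - integral {p'..q'} (E t) = integral {p'..q'} (\<lambda>x. F t x - E t x)"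
      using that by (intro Henstock_Kurzweil_Integration.integral_diff[symmetric] integrable_continuous_real
          continuous_on_slices(1)[OF contF] continuous_on_slices(1)[OF contE]) auto
    also have "(\<lambda>x. F t x - E t x) = (\<lambda>x. a t * (c' x * (\<rho> t x * speed t x) - c x * \<rho>t t x))"
      by (auto simp: F_def E_def algebra_simps)
    finally show ?thesis by (simp add: P_def)
  qed
  have "integral {0..q} (\<lambda>t. a t * P t) = integral {0..q} (\<lambda>t. integral {p'..q'} (F t) - integral {p'..q'} (E t))"
    by (rule Henstock_Kurzweil_Integration.integral_cong) (simp add: P)
  also have "\<dots> = integral {0..q} (\<lambda>t. integral {p'..q'} (F t)) - integral {0..q} (\<lambda>t. integral {p'..q'} (E t))"
  proof (intro Henstock_Kurzweil_Integration.integral_diff integrable_continuous_real)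
    show "continuous_on {0..q} (\<lambda>t. integral {p'..q'} (F t))"
      by (rule continuous_on_subset[OF continuous_on_partial_integral[OF contF]]) auto
    show "continuous_on {0..q} (\<lambda>t. integral {p'..q'} (E t))"
      by (rule continuous_on_subset[OF continuous_on_partial_integral[OF contE]]) auto
  qed
  finally show ?thesis unfolding 1 2 by (simp add: algebra_simps)
qed

text \<open>The fundamental lemma in time, with functions \<open>a\<close> supported in \<open>t > 0\<close>; the conclusion holds at
every \<open>t > 0\<close> because the left-hand side is continuous in \<open>t\<close>.\<close>

lemma tested_equation_pos_time:
  assumes c: "C2 c" "\<And>x. x \<notin> {p'<..<q'} \<Longrightarrow> c x = 0"
    and c': "\<And>x. (c has_real_derivative c' x) (at x)" "continuous_on UNIV c'"
    and "p' < q'" "t > 0"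
  shows "integral {p'..q'} (\<lambda>x. c' x * (\<rho> t x * speed t x) - c x * \<rho>t t x) = 0"
proof -
  define P where "P = (\<lambda>t. integral {p'..q'} (\<lambda>x. c' x * (\<rho> t x * speed t x) - c x * \<rho>t t x))"
  have contc: "continuous_on UNIV c" by (rule DERIV_everywhere_continuous[OF c'(1)])
  have pair: "continuous_on A (\<lambda>(t, x). f x)"
    if "continuous_on UNIV f" for f :: "real \<Rightarrow> real" and A :: "(real \<times> real) set"
    unfolding case_prod_unfold by (auto intro!: continuous_on_compose2[OF that] continuous_intros)
  have contP: "continuous_on {0..} P"
    unfolding P_def
    by (intro continuous_on_partial_integral continuous_on_pair pair c' contc continuous_\<rho> continuous_speed continuous_\<rho>t)
  have "integrable lebesgue (\<lambda>t. a t * P t) \<and> (LINT t|lebesgue. a t * P t) = 0" if a: "a \<in> bumps {0<..}" for a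
  proof (rule bumps_support[OF a])
    fix p q assume pq: "p < q" "{p..q} \<subseteq> {0<..}" "\<And>t. t \<notin> {p<..<q} \<Longrightarrow> a t = 0"
    have "p \<in> {p..q}" using pq(1) by simp
    then have "p > 0" using pq(2) by blast
    have conta: "continuous_on UNIV a" by (rule C2E[OF C2_bumps[OF a]])
    have cont: "continuous_on {0..q} (\<lambda>t. a t * P t)"
      by (intro continuous_intros continuous_on_subset[OF conta] continuous_on_subset[OF contP]) auto
    have out: "a t * P t = 0" if "t \<notin> {0..q}" for t using that pq(3)[of t] \<open>p > 0\<close> by auto
    have "(LINT t|lebesgue. a t * P t) = integral {0..q} (\<lambda>t. a t * P t)"
      by (rule lebesgue_integral_supported(2)[OF cont out])
    also have "\<dots> = a 0 * ((LINT x|lebesgue. c x * \<rho> 0 x) - (LINT x|lebesgue. c x * \<rho>0 x))"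
      unfolding P_def
      by (rule tested_continuity_equation[OF C2_bumps[OF a] pq(3) c c' _ \<open>p' < q'\<close>]) (use pq(1) \<open>p > 0\<close> in auto)
    also have "a 0 = 0" using pq(3)[of 0] \<open>p > 0\<close> by auto
    finally show ?thesis using lebesgue_integral_supported(1)[OF cont out] by simp
  qed simp
  then have "AE t in lebesgue. t \<in> {0<..} \<longrightarrow> P t = 0"
    by (intro AE_zero_if_bump_integrals_zero[OF open_greaterThan]) auto
  then have "P t \<in> {0}"
    using \<open>t > 0\<close>
    by (intro AE_in_closed_imp_all[where f = P and x = t,
          OF open_greaterThan continuous_on_subset[OF contP] closed_singleton[of 0]]) auto
  then show ?thesis by (simp add: P_def)
qed

text \<open>Integration by parts in \<open>x\<close> moves the derivative from \<open>c\<close> to the flux; the fundamental lemma in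
\<open>x\<close> then yields the equation almost everywhere, and continuity everywhere.\<close>

lemma pde_pos_time:
  assumes t: "t > 0"
  shows "\<rho>t t x + flux_x t x = 0"
proof -
  let ?E = "\<lambda>x. \<rho>t t x + flux_x t x"
  have contf: "continuous_on A (flux_x t)" for A
    using t by (intro continuous_on_slices(1)[OF continuous_flux_x]) simp
  have cont\<rho>t: "continuous_on A (\<rho>t t)" for A
    using t by (intro continuous_on_slices(1)[OF continuous_\<rho>t]) simp
  have contE: "continuous_on UNIV ?E" by (intro continuous_intros contf cont\<rho>t)
  have "(LINT x|lebesgue. c x * ?E x) = 0" if c: "c \<in> bumps UNIV" for c
  proof (rule bumps_support[OF c])
    fix p q assume pq: "p < q" "\<And>x. x \<notin> {p<..<q} \<Longrightarrow> c x = 0"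
    obtain c' where c': "\<And>x. (c has_real_derivative c' x) (at x)" "continuous_on UNIV c" "continuous_on UNIV c'"
      using C2E[OF C2_bumps[OF c]] by metis
    note cs = continuous_on_subset[OF c'(2) subset_UNIV] continuous_on_subset[OF c'(3) subset_UNIV]
    have contfl: "continuous_on A (\<lambda>x. \<rho> t x * speed t x)" for A
      using t by (intro continuous_intros continuous_profile continuous_on_slices(1)[OF continuous_speed]) auto
    have i1: "(\<lambda>x. c' x * (\<rho> t x * speed t x) - c x * \<rho>t t x) integrable_on {p..q}"
      by (intro integrable_continuous_real continuous_intros cs contfl cont\<rho>t)
    have i2: "((\<lambda>x. c' x * (\<rho> t x * speed t x) + flux_x t x * c x) has_integral
        c q * (\<rho> t q * speed t q) - c p * (\<rho> t p * speed t p)) {p..q}"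
    proof (rule fundamental_theorem_of_calculus)
      fix x
      have "((\<lambda>y. c y * (\<rho> t y * speed t y)) has_real_derivative c' x * (\<rho> t x * speed t x) + flux_x t x * c x) (at x)"
        by (intro DERIV_mult c'(1) DERIV_flux t)
      then show "((\<lambda>y. c y * (\<rho> t y * speed t y)) has_vector_derivative c' x * (\<rho> t x * speed t x) + flux_x t x * c x) (at x within {p..q})"
        by (simp add: has_real_derivative_iff_has_vector_derivative has_vector_derivative_at_within)
    qed (use pq in simp)
    have z: "c p = 0" "c q = 0" using pq(2)[of p] pq(2)[of q] by auto
    have "(LINT x|lebesgue. c x * ?E x) = integral {p..q} (\<lambda>x. c x * ?E x)"
      by (rule lebesgue_integral_supported(2))
        (use pq in \<open>auto intro!: continuous_intros cs contf cont\<rho>t\<close>)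
    also have "\<dots> = integral {p..q} (\<lambda>x. (c' x * (\<rho> t x * speed t x) + flux_x t x * c x) - (c' x * (\<rho> t x * speed t x) - c x * \<rho>t t x))"
      by (rule Henstock_Kurzweil_Integration.integral_cong) (simp add: algebra_simps)
    also have "\<dots> = integral {p..q} (\<lambda>x. c' x * (\<rho> t x * speed t x) + flux_x t x * c x)
        - integral {p..q} (\<lambda>x. c' x * (\<rho> t x * speed t x) - c x * \<rho>t t x)"
      using i2 i1 by (intro Henstock_Kurzweil_Integration.integral_diff) auto
    also have "\<dots> = 0"
      using integral_unique[OF i2] z tested_equation_pos_time[OF C2_bumps[OF c] pq(2) c'(1,3) pq(1) t] by simp
    finally show ?thesis .
  qed simp
  moreover have "integrable lebesgue (\<lambda>x. c x * ?E x)" if "c \<in> bumps UNIV" for c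
    by (rule integrable_bumps_continuous[OF that contE])
  ultimately have "AE x in lebesgue. x \<in> UNIV \<longrightarrow> ?E x = 0"
    by (intro AE_zero_if_bump_integrals_zero[OF open_UNIV])
  then have "?E x \<in> {0}"
    by (intro AE_in_closed_imp_all[where f = ?E and x = x, OF open_UNIV contE closed_singleton[of 0]]) auto
  then show ?thesis by simp
qed

text \<open>Now \<open>a(0) > 0\<close>, while the left-hand side of the tested equation is already known to vanish.\<close>

lemma initial_condition: "AE x in lebesgue. \<rho> 0 x = \<rho>0 x"
proof -
  have int: "integrable lebesgue (\<lambda>x. c x * \<rho> 0 x)" "integrable lebesgue (\<lambda>x. c x * \<rho>0 x)" if "c \<in> bumps UNIV" for c
    by (rule integrable_bumps_continuous[OF that continuous_profile], simp)
      (rule integrable_bumps_mult[OF that integrable_\<rho>0])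
  have "(LINT x|lebesgue. c x * \<rho> 0 x) = (LINT x|lebesgue. c x * \<rho>0 x)" if c: "c \<in> bumps UNIV" for c
  proof (rule bumps_support[OF c])
    fix p q assume pq: "p < q" "\<And>x. x \<notin> {p<..<q} \<Longrightarrow> c x = 0"
    obtain c' where c': "\<And>x. (c has_real_derivative c' x) (at x)" "continuous_on UNIV c" "continuous_on UNIV c'"
      using C2E[OF C2_bumps[OF c]] by metis
    \<comment> \<open>Its restriction to \<open>t \<ge> 0\<close> is an admissible temporal factor that is positive at \<open>t = 0\<close>.\<close>
    let ?a = "bump (-1) 1 1"
    let ?P = "\<lambda>t. integral {p..q} (\<lambda>x. c' x * (\<rho> t x * speed t x) - c x * \<rho>t t x)"
    have "integral {0..1} (\<lambda>t. ?a t * ?P t) =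
        ?a 0 * ((LINT x|lebesgue. c x * \<rho> 0 x) - (LINT x|lebesgue. c x * \<rho>0 x))"
      by (rule tested_continuity_equation[OF C2_bump, of "-1" 1, OF bump_outside C2_bumps[OF c] pq(2) c'(1,3) _ pq(1)]) auto
    moreover have "integral {0..1} (\<lambda>t. ?a t * ?P t) = integral {0..1} (\<lambda>t::real. 0)"
    proof (rule integral_spike[of "{0}"])
      show "0 = ?a t * ?P t" if "t \<in> {0..1} - {0}" for t
        using tested_equation_pos_time[OF C2_bumps[OF c] pq(2) c'(1,3) pq(1), of t] that by simp
    qed simp
    moreover have "?a 0 > 0" by (rule bump_pos) auto
    ultimately show ?thesis by simp
  qed simp
  then have "AE x in lebesgue. x \<in> UNIV \<longrightarrow> \<rho> 0 x - \<rho>0 x = 0"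
    using int by (intro AE_zero_if_bump_integrals_zero[OF open_UNIV]) (auto simp: right_diff_distrib)
  then show ?thesis by (rule eventually_mono) auto
qed

end

lemma (in weak_density) weak_imp_classical_solution:
  assumes reg: "solution_regularity R \<rho>" and \<rho>0: "\<rho>0 \<in> X_space R"
  shows "classical_solution R \<kappa> h \<rho>0 \<rho>" "cond_A R \<rho>" "cond_B \<kappa> \<rho>" "cond_C R \<rho>"
proof -
  show "classical_solution R \<kappa> h \<rho>0 \<rho>"
    unfolding classical_solution_def
    using reg \<rho>_tendsto_0 initial_condition by (simp add: pde_iff pde_pos_time)
  have X: "L1_Linf (\<rho> t)" "ess_inf (\<rho> t) = 0" if "t \<ge> 0" for t
    using weak that unfolding weak_solution_def by blast+
  obtain m where "m < R" "\<And>t x. t \<ge> 0 \<Longrightarrow> \<rho> t x \<le> m"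
    by (rule \<rho>_bound) (rule that; assumption)
  then show "cond_A R \<rho>"
    unfolding cond_A_iff using INF_eq_0_of_ess_inf X(2) by blast
  show "cond_B \<kappa> \<rho>"
    unfolding cond_B_iff by (rule slope_bounded) blast
  have "ess_sup (\<rho> t) < ereal R" if "t \<ge> 0" for t
  proof -
    have "ess_sup (\<rho> t) \<le> (SUP t\<in>{0..}. ess_sup (\<rho> t))" by (rule SUP_upper) (use that in simp)
    also have "\<dots> < ereal R" using weak unfolding weak_solution_def by blast
    finally show ?thesis .
  qed
  moreover have "ess_tendsto (\<rho> t) 0 F" if "t \<ge> 0" "F = at_top \<or> F = at_bot" for t F
  proof (cases "t = 0")
    case True
    have "ess_tendsto \<rho>0 0 F" using \<rho>0 that(2) unfolding X_space_def by blast
    then obtain g where "AE x in lebesgue. g x = \<rho>0 x" "(g \<longlongrightarrow> 0) F" unfolding ess_tendsto_def by blast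
    moreover from this(1) initial_condition have "AE x in lebesgue. g x = \<rho> 0 x" by eventually_elim simp
    ultimately show ?thesis unfolding ess_tendsto_def True by blast
  next
    case False
    then show ?thesis using that weak unfolding weak_solution_def by auto
  qed
  ultimately show "cond_C R \<rho>"
    unfolding cond_C_def X_space_def using X by blast
qed

section \<open>The equivalence\<close>

theorem proposition1:
  fixes R b :: real and \<kappa> h \<rho>0 :: "real \<Rightarrow> real"
  assumes "R > 1" and "b > 0"
    and "C1_on {0..<R} \<kappa>" and "\<forall>r\<in>{0..<R}. \<kappa> r \<ge> 0"
    and "\<forall>r\<in>{0..1}. \<kappa> r = 0" and "\<forall>r\<in>{1<..<R}. \<kappa> r > 0"
    and "h C1_differentiable_on UNIV" and "Linf lebesgue (deriv h)"
    and "h 0 = 0" and "\<forall>s. deriv h s > 0" and "range h = {-1<..<b}"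
    and "\<rho>0 \<in> X_space R"
  shows "(\<forall>\<rho>. classical_solution R \<kappa> h \<rho>0 \<rho> \<and> cond_A R \<rho> \<and> cond_B \<kappa> \<rho> \<and> cond_C R \<rho>
            \<longrightarrow> weak_solution R b \<kappa> h \<rho>0 \<rho> (velocity \<kappa> h \<rho>))
       \<and> (\<forall>\<rho> w. weak_solution R b \<kappa> h \<rho>0 \<rho> w \<and> solution_regularity R \<rho>
            \<longrightarrow> classical_solution R \<kappa> h \<rho>0 \<rho> \<and> cond_A R \<rho> \<and> cond_B \<kappa> \<rho> \<and> cond_C R \<rho>)"
proof -
  obtain \<kappa>' where \<kappa>': "\<And>r. r \<in> {0..<R} \<Longrightarrow> (\<kappa> has_real_derivative \<kappa>' r) (at r within {0..<R})" "continuous_on {0..<R} \<kappa>'"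
    using assms(3) unfolding C1_on_def by blast
  obtain h' where h': "\<And>s. (h has_real_derivative h' s) (at s)" "continuous_on UNIV h'"
    using assms(7) unfolding C1_differentiable_on_def has_real_derivative_iff_has_vector_derivative by blast
  have "deriv h = h'" using h'(1) by (auto intro: DERIV_imp_deriv)
  with h' interpret diffusion_data R b \<kappa> h \<kappa>'
    by unfold_locales (use assms \<kappa>' in simp_all)
  have reg: "\<exists>\<rho>t \<rho>x \<rho>xx. regular_density R b \<kappa> h \<kappa>' \<rho> \<rho>t \<rho>x \<rho>xx" if "solution_regularity R \<rho>" for \<rho>
  proof (rule solution_regularity_partials[OF that])
    fix \<rho>t \<rho>x \<rho>xx
    assume *: "continuous_on half_plane (\<lambda>(t, x). \<rho> t x)"
      "continuous_on half_plane (\<lambda>(t, x). \<rho>t t x)"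
      "continuous_on half_plane (\<lambda>(t, x). \<rho>x t x)"
      "continuous_on open_half_plane (\<lambda>(t, x). \<rho>xx t x)"
      "\<And>t x. t \<ge> 0 \<Longrightarrow> (\<rho> t has_real_derivative \<rho>x t x) (at x)"
      "\<And>t x. t > 0 \<Longrightarrow> ((\<lambda>s. \<rho> s x) has_real_derivative \<rho>t t x) (at t)"
      "\<And>t x. t > 0 \<Longrightarrow> (\<rho>x t has_real_derivative \<rho>xx t x) (at x)"
    have range: "\<And>t x. t \<ge> 0 \<Longrightarrow> \<rho> t x \<in> {0..<R}" using that unfolding solution_regularity_def by blast
    have "regular_density R b \<kappa> h \<kappa>' \<rho> \<rho>t \<rho>x \<rho>xx"
      by unfold_locales (assumption | rule * range)+
    then show ?thesis by blast
  qed
  have "weak_solution R b \<kappa> h \<rho>0 \<rho> (velocity \<kappa> h \<rho>)"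
    if "classical_solution R \<kappa> h \<rho>0 \<rho>" "cond_A R \<rho>" "cond_B \<kappa> \<rho>" "cond_C R \<rho>" for \<rho>
  proof -
    have "solution_regularity R \<rho>" using that(1) unfolding classical_solution_def by blast
    then obtain \<rho>t \<rho>x \<rho>xx where "regular_density R b \<kappa> h \<kappa>' \<rho> \<rho>t \<rho>x \<rho>xx" using reg by blast
    then show ?thesis using that by (rule regular_density.classical_imp_weak_solution)
  qed
  moreover have "classical_solution R \<kappa> h \<rho>0 \<rho> \<and> cond_A R \<rho> \<and> cond_B \<kappa> \<rho> \<and> cond_C R \<rho>"
    if "weak_solution R b \<kappa> h \<rho>0 \<rho> w" "solution_regularity R \<rho>" for \<rho> w
  proof -
    from reg[OF that(2)] obtain \<rho>t \<rho>x \<rho>xx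
      where "regular_density R b \<kappa> h \<kappa>' \<rho> \<rho>t \<rho>x \<rho>xx" by blast
    moreover have "integrable lebesgue \<rho>0" using assms(12) unfolding X_space_def by blast
    ultimately have "weak_density R b \<kappa> h \<kappa>' \<rho> \<rho>t \<rho>x \<rho>xx \<rho>0 w"
      using that(1) by (simp add: weak_density_def weak_density_axioms_def)
    from weak_density.weak_imp_classical_solution[OF this that(2) assms(12)] show ?thesis by blast
  qed
  ultimately show ?thesis by blast
qed

end
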